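(* Let $h_1,h_2\in\mathcal H=L^2(\mathbb R,\mathcal B(\mathbb R),\mu)$. The process $\Bigl(\int_0^t\Phi(h_1)_s\,d\Phi(h_2)_s\Bigr)_{t\ge0}$ admits a continuous modification, i.e. there is a process $(\widetilde Z_t)_{t\ge0}$ on the same probability space with continuous paths such that for every $t\ge0$, $\widetilde Z_t=\int_0^t\Phi(h_1)_s\,d\Phi(h_2)_s$ $P$-almost surely.
   Context: Setting. $\mu$ is a diffuse (atomless) $\sigma$-finite measure on $(\mathbb R,\mathcal B(\mathbb R))$, $\mathcal H=L^2(\mathbb R,\mathcal B(\mathbb R),\mu)$ (real) with inner product $\langle\cdot,\cdot\rangle$ and a fixed Hilbert (orthonormal) basis $(e_n)_{n\in\mathbb N}$, $\mathbb N=\{0,1,2,\dots\}$. $(P_n)_{n\in\mathbb N}$ are probability measures on $\mathbb R$ with $\int x\,dP_n=0$, $\int x^2\,dP_n=1$, and for every $p>0$ there is $K_p$ with $\int|x|^p\,dP_n\le K_p$ for all $n$. $P=\bigotimes_n P_n$ on $\mathbb R^{\mathbb N}$, $L^2(P)=L^2(\mathbb R^{\mathbb N},P)$, and $X_n$ are the coordinate projections (hence independent, $X_n\sim P_n$). The map $\phi:\mathcal H\to L^2(P)$ is the linear isometry $\phi(h)=\sum_{k\ge0}\langle h,e_k\rangle X_k$ (series in $L^2(P)$). For $s\ge0$, $\Phi(h)_s:=\phi(h1_{]0,s]})$. Tensors: $(h\otimes g)(x,y)=h(x)g(y)$, and $\mathcal H\otimes\mathcal H=L^2(\mu\otimes\mu)$.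 For $f\in\mathcal H\otimes\mathcal H$ define, as limits in $L^2(P)$ (which exist), $$\varphi^{(2)}(f)=\sum_{j=0}^{\infty}\langle f,e_j\otimes e_j\rangle (X_j^2-1),\qquad \varphi^{(1,1)}(f)=\sum_{j=1}^{\infty}\Bigl(\sum_{k=0}^{j-1}\langle f,e_j\otimes e_k\rangle X_k\Bigr)X_j .$$ Double integral: for $t\ge0$ let $C_t=\{(x,y):0\le x<y\le t\}$ and $\widetilde C_t=\{(x,y):0\le y<x\le t\}$. For $h,g\in\mathcal H$, $$\int_0^t\Phi(h)_s\,d\Phi(g)_s:=\varphi^{(1,1)}\bigl(h\otimes g\,1_{C_t}+g\otimes h\,1_{\widetilde C_t}\bigr)+\varphi^{(2)}\bigl(h\otimes g\,1_{C_t}\bigr),$$ an element of $L^2(P)$. *)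

theory Defs
  imports "HOL-Probability.Probability"
begin

definition square_integrable :: "'a measure \<Rightarrow> ('a \<Rightarrow> real) \<Rightarrow> bool" where
  "square_integrable M f \<longleftrightarrow> f \<in> borel_measurable M \<and> integrable M (\<lambda>x. (f x)\<^sup>2)"

definition L2_inner :: "'a measure \<Rightarrow> ('a \<Rightarrow> real) \<Rightarrow> ('a \<Rightarrow> real) \<Rightarrow> real" where
  "L2_inner M f g = (\<integral>x. f x * g x \<partial>M)"

text \<open>Elements of \<open>L\<^sup>2\<close> are represented by functions, so the orthonormal basis below is a sequence
  of representatives. Completeness is density of the finite linear combinations.\<close>

definition hilbert_basis :: "'a measure \<Rightarrow> (nat \<Rightarrow> 'a \<Rightarrow> real) \<Rightarrow> bool" where
  "hilbert_basis M e \<longleftrightarrow>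
     (\<forall>n. square_integrable M (e n)) \<and>
     (\<forall>m n. L2_inner M (e m) (e n) = (if m = n then 1 else 0)) \<and>
     (\<forall>f. square_integrable M f \<longrightarrow>
        (\<forall>\<epsilon>>0. \<exists>N c. (\<integral>x. (f x - (\<Sum>k<N. c k * e k x))\<^sup>2 \<partial>M) < \<epsilon>))"

text \<open>Square integrability of all \<open>S n\<close> and of \<open>Z\<close> is part of the definition, since the Bochner
  integral of a non-integrable function is \<open>0\<close>.\<close>

definition L2_limit ::
  "'a measure \<Rightarrow> (nat \<Rightarrow> 'a \<Rightarrow> real) \<Rightarrow> ('a \<Rightarrow> real) \<Rightarrow> bool" where
  "L2_limit M S Z \<longleftrightarrow>
     (\<forall>n. square_integrable M (S n)) \<and> square_integrable M Z \<and>
     (\<lambda>n. \<integral>x. (S n x - Z x)\<^sup>2 \<partial>M) \<longlonglongrightarrow> 0"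

text \<open>A representative of the limit; it is determined only up to null sets
  (lemma \<open>L2_limit_unique\<close>).\<close>

definition L2_lim :: "'a measure \<Rightarrow> (nat \<Rightarrow> 'a \<Rightarrow> real) \<Rightarrow> 'a \<Rightarrow> real" where
  "L2_lim M S = (SOME Z. L2_limit M S Z)"

lemma square_integrable_diff:
  assumes "square_integrable M f" "square_integrable M g"
  shows "integrable M (\<lambda>x. (f x - g x)\<^sup>2)"
proof (rule Bochner_Integration.integrable_bound)
  show "integrable M (\<lambda>x. 2 * (f x)\<^sup>2 + 2 * (g x)\<^sup>2)"
    using assms by (auto simp: square_integrable_def)
  show "(\<lambda>x. (f x - g x)\<^sup>2) \<in> borel_measurable M"
    using assms by (auto simp: square_integrable_def)
  have "(a - b)\<^sup>2 \<le> 2 * a\<^sup>2 + 2 * b\<^sup>2" for a b :: real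
    using zero_le_power2[of "a + b"] by (simp add: power2_eq_square algebra_simps)
  then show "AE x in M. norm ((f x - g x)\<^sup>2) \<le> norm (2 * (f x)\<^sup>2 + 2 * (g x)\<^sup>2)"
    by auto
qed

lemma L2_limit_unique:
  assumes "L2_limit M S Z" "L2_limit M S Z'"
  shows "AE x in M. Z x = Z' x"
proof -
  let ?I = "\<integral>x. (Z x - Z' x)\<^sup>2 \<partial>M"
  have sq: "square_integrable M Z" "square_integrable M Z'" "\<And>n. square_integrable M (S n)"
    using assms by (auto simp: L2_limit_def)
  have ab: "(a - b)\<^sup>2 \<le> 2 * (c - a)\<^sup>2 + 2 * (c - b)\<^sup>2" for a b c :: real
    using zero_le_power2[of "(c - a) + (c - b)"] by (simp add: power2_eq_square algebra_simps)
  have le: "?I \<le> 2 * (\<integral>x. (S n x - Z x)\<^sup>2 \<partial>M) + 2 * (\<integral>x. (S n x - Z' x)\<^sup>2 \<partial>M)" for n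
  proof -
    have "?I \<le> (\<integral>x. 2 * (S n x - Z x)\<^sup>2 + 2 * (S n x - Z' x)\<^sup>2 \<partial>M)"
      by (intro integral_mono Bochner_Integration.integrable_add integrable_mult_right square_integrable_diff sq ab)
    then show ?thesis
      by (simp add: square_integrable_diff sq)
  qed
  have "(\<lambda>n. 2 * (\<integral>x. (S n x - Z x)\<^sup>2 \<partial>M) + 2 * (\<integral>x. (S n x - Z' x)\<^sup>2 \<partial>M))
      \<longlonglongrightarrow> 2 * 0 + 2 * 0"
    using assms by (intro tendsto_intros) (auto simp: L2_limit_def)
  then have "?I \<le> 2 * 0 + 2 * 0"
    by (rule LIMSEQ_le_const) (use le in blast)
  moreover have "0 \<le> ?I"
    by simp
  ultimately have "?I = 0"
    by linarith
  then have "AE x in M. (Z x - Z' x)\<^sup>2 = 0"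
    using integral_nonneg_eq_0_iff_AE[OF square_integrable_diff[OF sq(1,2)]] by simp
  then show ?thesis
    by simp
qed

text \<open>The law \<open>P = \<Otimes>\<^sub>n P\<^sub>n\<close> on \<open>\<real>\<^sup>\<nat>\<close>; the coordinate projection \<open>X\<^sub>n\<close> is \<open>\<lambda>\<omega>. \<omega> n\<close>.\<close>

definition path_measure :: "(nat \<Rightarrow> real measure) \<Rightarrow> (nat \<Rightarrow> real) measure" where
  "path_measure P = (\<Pi>\<^sub>M n\<in>UNIV. P n)"

definition tensor :: "(real \<Rightarrow> real) \<Rightarrow> (real \<Rightarrow> real) \<Rightarrow> real \<times> real \<Rightarrow> real" (infixr "\<otimes>\<^sub>t" 75)
  where "h \<otimes>\<^sub>t g = (\<lambda>(x, y). h x * g y)"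

definition phi2 ::
  "real measure \<Rightarrow> (nat \<Rightarrow> real \<Rightarrow> real) \<Rightarrow> (nat \<Rightarrow> real measure) \<Rightarrow>
   (real \<times> real \<Rightarrow> real) \<Rightarrow> (nat \<Rightarrow> real) \<Rightarrow> real" where
  "phi2 \<mu> e P f = L2_lim (path_measure P)
     (\<lambda>N \<omega>. \<Sum>j=0..N. L2_inner (\<mu> \<Otimes>\<^sub>M \<mu>) f (e j \<otimes>\<^sub>t e j) * ((\<omega> j)\<^sup>2 - 1))"

definition phi11 ::
  "real measure \<Rightarrow> (nat \<Rightarrow> real \<Rightarrow> real) \<Rightarrow> (nat \<Rightarrow> real measure) \<Rightarrow>
   (real \<times> real \<Rightarrow> real) \<Rightarrow> (nat \<Rightarrow> real) \<Rightarrow> real" where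
  "phi11 \<mu> e P f = L2_lim (path_measure P)
     (\<lambda>N \<omega>. \<Sum>j=1..N. (\<Sum>k<j. L2_inner (\<mu> \<Otimes>\<^sub>M \<mu>) f (e j \<otimes>\<^sub>t e k) * \<omega> k) * \<omega> j)"

definition upper_triangle :: "real \<Rightarrow> (real \<times> real) set" where
  "upper_triangle t = {(x, y). 0 \<le> x \<and> x < y \<and> y \<le> t}"

definition lower_triangle :: "real \<Rightarrow> (real \<times> real) set" where
  "lower_triangle t = {(x, y). 0 \<le> y \<and> y < x \<and> x \<le> t}"

text \<open>The double integral \<open>\<integral>\<^sub>0\<^sup>t \<Phi>(h)\<^sub>s d\<Phi>(g)\<^sub>s\<close>.\<close>

definition double_integral ::
  "real measure \<Rightarrow> (nat \<Rightarrow> real \<Rightarrow> real) \<Rightarrow> (nat \<Rightarrow> real measure) \<Rightarrow>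
   (real \<Rightarrow> real) \<Rightarrow> (real \<Rightarrow> real) \<Rightarrow> real \<Rightarrow> (nat \<Rightarrow> real) \<Rightarrow> real" where
  "double_integral \<mu> e P h g t = (\<lambda>\<omega>.
     phi11 \<mu> e P (\<lambda>z. (h \<otimes>\<^sub>t g) z * indicator (upper_triangle t) z
                    + (g \<otimes>\<^sub>t h) z * indicator (lower_triangle t) z) \<omega>
   + phi2 \<mu> e P (\<lambda>z. (h \<otimes>\<^sub>t g) z * indicator (upper_triangle t) z) \<omega>)"

end

(*
  The increments of the double integral are L^2 limits of quadratic forms in the independent
  coordinates. Revealing the coordinates one by one writes such a form as a sum of martingale
  differences, and expanding the fourth power bounds its fourth moment by a constant times the
  square of the sum of the squared coefficients. By Bessel's inequality in L^2(mu x mu) this is at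
  most C * (H t - H s)^2, where H is the distribution function of the finite measure h_2^2 mu, which
  is continuous since mu is diffuse. After a time change by H, Kolmogorov's continuity criterion
  with fourth moments applies.
*)

theory Submission
  imports Defs
begin

section \<open>Convergence in mean square\<close>

text \<open>Fourth moments are forced by the size of the increments: their second moments are only
  known to be of order \<open>H t - H s\<close>, exponent one, which a compensated Poisson process
  also satisfies; squaring the moment squares the bound. The coordinates are not Gaussian, so
  hypercontractivity of a chaos is not at hand, and the bounds have to be uniform in the truncation
  and in the laws. Revealing \<open>X n\<close> adds \<open>L * X n + b n * ((X n)^2 - 1)\<close>
  with \<open>L\<close> linear in the past, so one inequality for sums serves twice, for
  \<open>L\<close> and for the whole form; eighth moments enter through the fourth power of
  \<open>(X n)^2\<close>. The double integral at time t is a representative chosen separately for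
  each t, so nothing is known about its paths. All that is used is that each value is a mean square
  limit; moment bounds reach it by Fatou along an almost everywhere convergent subsequence. Almost
  sure convergence is always drawn from summable expectations.\<close>

lemma AE_summable_if_summable_integral:
  fixes f :: "nat \<Rightarrow> 'a \<Rightarrow> real"
  assumes int: "\<And>n. integrable M (f n)" and nonneg: "\<And>n x. 0 \<le> f n x"
    and sum: "summable (\<lambda>n. \<integral>x. f n x \<partial>M)"
  shows "AE x in M. summable (\<lambda>n. f n x)"
proof -
  have [measurable]: "f n \<in> borel_measurable M" for n
    using int by blast
  have "(\<integral>\<^sup>+x. (\<Sum>n. ennreal (f n x)) \<partial>M) = (\<Sum>n. \<integral>\<^sup>+x. ennreal (f n x) \<partial>M)"
    by (rule nn_integral_suminf) simp
  also have "\<dots> = (\<Sum>n. ennreal (\<integral>x. f n x \<partial>M))"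
    by (simp add: nn_integral_eq_integral int nonneg)
  also have "\<dots> \<noteq> \<infinity>"
    unfolding infinity_ennreal_def
    by (rule ennreal_suminf_neq_top[OF sum]) (simp add: nonneg integral_nonneg_AE)
  finally have "AE x in M. (\<Sum>n. ennreal (f n x)) \<noteq> \<infinity>"
    by (intro nn_integral_PInf_AE) auto
  then show ?thesis
    by eventually_elim (intro summable_suminf_not_top, auto simp: nonneg)
qed

text \<open>Integrability of the limit is a conclusion of its own: the Bochner integral of a
  non-integrable function is 0, which would make the bound on the integral empty.\<close>

lemma fatou_integral_le:
  fixes f :: "nat \<Rightarrow> 'a \<Rightarrow> real"
  assumes int: "\<And>n. integrable M (f n)" and nonneg: "\<And>n x. 0 \<le> f n x"
    and [measurable]: "g \<in> borel_measurable M"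
    and lim: "AE x in M. (\<lambda>n. f n x) \<longlonglongrightarrow> g x"
    and bound: "\<And>n. (\<integral>x. f n x \<partial>M) \<le> C"
  shows "integrable M g" and "(\<integral>x. g x \<partial>M) \<le> C"
proof -
  have [measurable]: "f n \<in> borel_measurable M" for n
    using int by blast
  have "0 \<le> (\<integral>x. f 0 x \<partial>M)"
    by (simp add: nonneg)
  then have C: "0 \<le> C"
    using bound[of 0] by linarith
  have g: "AE x in M. 0 \<le> g x"
    using lim by eventually_elim (rule LIMSEQ_le_const, auto simp: nonneg)
  have "(\<integral>\<^sup>+x. ennreal (g x) \<partial>M) = (\<integral>\<^sup>+x. liminf (\<lambda>n. ennreal (f n x)) \<partial>M)"
    using lim by (intro nn_integral_cong_AE, eventually_elim)
      (metis lim_imp_Liminf sequentially_bot tendsto_ennrealI)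
  also have "\<dots> \<le> liminf (\<lambda>n. \<integral>\<^sup>+x. ennreal (f n x) \<partial>M)"
    by (rule nn_integral_liminf) simp
  also have "\<dots> = liminf (\<lambda>n. ennreal (\<integral>x. f n x \<partial>M))"
    by (simp add: nn_integral_eq_integral int nonneg)
  also have "\<dots> \<le> liminf (\<lambda>n. ennreal C)"
    by (intro Liminf_mono always_eventually allI ennreal_leI bound)
  also have "\<dots> = ennreal C"
    by (simp add: Liminf_const)
  finally have le: "(\<integral>\<^sup>+x. ennreal (g x) \<partial>M) \<le> ennreal C" .
  show "integrable M g"
    using g le by (intro integrableI_nonneg) (auto intro: order.strict_trans1)
  then have "(\<integral>\<^sup>+x. ennreal (g x) \<partial>M) = ennreal (\<integral>x. g x \<partial>M)"
    using g by (rule nn_integral_eq_integral)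
  with le C show "(\<integral>x. g x \<partial>M) \<le> C"
    by simp
qed

text \<open>The Riesz-Fischer argument: a subsequence with squared distances at most 4^-k converges
  almost everywhere, and Fatou turns its limit into the mean square limit of the whole
  sequence.\<close>

lemma L2_limit_if_Cauchy:
  assumes sq: "\<And>n. square_integrable M (S n)"
    and cauchy: "\<And>\<epsilon>. \<epsilon> > 0 \<Longrightarrow> \<exists>N. \<forall>m\<ge>N. \<forall>n\<ge>N. (\<integral>x. (S m x - S n x)\<^sup>2 \<partial>M) \<le> \<epsilon>"
  shows "\<exists>Z. L2_limit M S Z"
proof -
  have [measurable]: "S n \<in> borel_measurable M" for n
    using sq by (auto simp: square_integrable_def)
  have "\<forall>k::nat. \<exists>N. \<forall>m\<ge>N. \<forall>n\<ge>N. (\<integral>x. (S m x - S n x)\<^sup>2 \<partial>M) \<le> (1/4)^k"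
    by (intro allI cauchy) simp
  then obtain N where N: "\<And>k m n. m \<ge> N k \<Longrightarrow> n \<ge> N k \<Longrightarrow> (\<integral>x. (S m x - S n x)\<^sup>2 \<partial>M) \<le> (1/4)^k"
    by metis
  \<comment> \<open>Summing the thresholds makes the indices monotone while keeping them above each
    \<open>N k\<close>.\<close>
  define r where "r k = (\<Sum>i\<le>k. N i)" for k
  have r_ge: "N k \<le> r k" for k
    unfolding r_def by (rule member_le_sum) auto
  have r_mono: "r j \<le> r k" if "j \<le> k" for j k
    unfolding r_def using that by (intro sum_mono2) auto
  have r: "(\<integral>x. (S m x - S n x)\<^sup>2 \<partial>M) \<le> (1/4)^k" if "m \<ge> r k" "n \<ge> r k" for k m n
    using N r_ge[of k] that by (meson order_trans)
  define g where "g k x = S (r (Suc k)) x - S (r k) x" for k x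
  have g_int: "integrable M (\<lambda>x. 2^k * (g k x)\<^sup>2)" for k
    unfolding g_def by (intro integrable_mult_right square_integrable_diff sq)
  have g_le: "(\<integral>x. 2^k * (g k x)\<^sup>2 \<partial>M) \<le> (1/2)^k" for k
  proof -
    have "(\<integral>x. 2^k * (g k x)\<^sup>2 \<partial>M) = 2^k * (\<integral>x. (g k x)\<^sup>2 \<partial>M)"
      by simp
    also have "\<dots> \<le> 2^k * (1/4)^k"
      unfolding g_def by (intro mult_left_mono r) (auto intro: r_mono)
    also have "\<dots> = (1/2)^k"
      by (simp flip: power_mult_distrib)
    finally show ?thesis .
  qed
  have "summable (\<lambda>k. \<integral>x. 2^k * (g k x)\<^sup>2 \<partial>M)"
  proof (rule summable_comparison_test'[of "\<lambda>k. (1/2::real)^k" 0])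
    show "norm (\<integral>x. 2^k * (g k x)\<^sup>2 \<partial>M) \<le> (1/2)^k" for k
      using g_le[of k] by (subst real_norm_def, subst abs_of_nonneg) (auto intro: integral_nonneg_AE)
  qed (simp add: summable_geometric)
  then have "AE x in M. summable (\<lambda>k. 2^k * (g k x)\<^sup>2)"
    by (intro AE_summable_if_summable_integral g_int) auto
  then have conv: "AE x in M. convergent (\<lambda>k. S (r k) x)"
  proof eventually_elim
    case (elim x)
    \<comment> \<open>The inequality \<open>a \<le> 1 / c + c * a^2\<close> with
      \<open>c = 2^k\<close> turns summability of the weighted squares into absolute summability of
      the increments; the weight still leaves the decay 2^-k.\<close>
    have "norm (g k x) \<le> (1/2)^k + 2^k * (g k x)\<^sup>2" for k
    proof -
      have *: "a \<le> 1 / c + c * a\<^sup>2" if "c > 0" for a c :: real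
      proof -
        have "0 \<le> (1 - c * a)\<^sup>2 + (c * a)\<^sup>2 + 1"
          by simp
        also have "\<dots> = 2 * c * (1 / c + c * a\<^sup>2 - a)"
          using that by (simp add: power2_eq_square field_simps)
        finally show ?thesis
          using that by (simp add: zero_le_mult_iff)
      qed
      show ?thesis
        using *[of "2^k" "\<bar>g k x\<bar>"] by (simp add: power_one_over)
    qed
    moreover have "summable (\<lambda>k. (1/2)^k + 2^k * (g k x)\<^sup>2)"
      by (intro summable_add elim summable_geometric) simp
    ultimately have "summable (\<lambda>k. g k x)"
      using summable_comparison_test'[of _ 0 "\<lambda>k. g k x"] by blast
    then have "convergent (\<lambda>n. \<Sum>k<n. g k x)"
      by (simp add: summable_iff_convergent)
    then have "convergent (\<lambda>n. S (r 0) x + (\<Sum>k<n. g k x))"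
      by (intro convergent_add convergent_const)
    moreover have "(\<Sum>k<n. g k x) = S (r n) x - S (r 0) x" for n
      unfolding g_def by (rule sum_lessThan_telescope)
    ultimately show ?case
      by simp
  qed
  define Z where "Z x = lim (\<lambda>k. S (r k) x)" for x
  have [measurable]: "Z \<in> borel_measurable M"
    unfolding Z_def by measurable
  have lim: "AE x in M. (\<lambda>k. S (r k) x) \<longlonglongrightarrow> Z x"
    using conv unfolding Z_def by eventually_elim (simp add: convergent_LIMSEQ_iff)
  \<comment> \<open>Only the second function runs along the subsequence; \<open>n\<close> is any
    index beyond \<open>r K\<close>, which is why the full sequence converges.\<close>
  have fatou: "integrable M (\<lambda>x. (S n x - Z x)\<^sup>2) \<and> (\<integral>x. (S n x - Z x)\<^sup>2 \<partial>M) \<le> (1/4)^K"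
    if "n \<ge> r K" for n K
  proof -
    have 1: "AE x in M. (\<lambda>k. (S n x - S (r (k + K)) x)\<^sup>2) \<longlonglongrightarrow> (S n x - Z x)\<^sup>2"
      using lim by eventually_elim (intro tendsto_intros LIMSEQ_ignore_initial_segment)
    have 2: "(\<integral>x. (S n x - S (r (k + K)) x)\<^sup>2 \<partial>M) \<le> (1/4)^K" for k
      using that by (intro r r_mono) auto
    show ?thesis
      using fatou_integral_le[OF square_integrable_diff[OF sq sq] _ _ 1 2] by simp
  qed
  have "integrable M (\<lambda>x. (Z x)\<^sup>2)"
  proof (rule Bochner_Integration.integrable_bound)
    show "integrable M (\<lambda>x. 2 * (S (r 0) x)\<^sup>2 + 2 * (S (r 0) x - Z x)\<^sup>2)"
      using fatou[of 0 "r 0"] sq[of "r 0"] by (simp add: square_integrable_def)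
    have "z\<^sup>2 \<le> 2 * s\<^sup>2 + 2 * (s - z)\<^sup>2" for s z :: real
      using zero_le_power2[of "2 * s - z"] by (simp add: power2_eq_square algebra_simps)
    then show "AE x in M. norm ((Z x)\<^sup>2) \<le> norm (2 * (S (r 0) x)\<^sup>2 + 2 * (S (r 0) x - Z x)\<^sup>2)"
      by auto
  qed simp
  moreover have "(\<lambda>n. \<integral>x. (S n x - Z x)\<^sup>2 \<partial>M) \<longlonglongrightarrow> 0"
  proof (rule LIMSEQ_I)
    fix \<epsilon> :: real assume "\<epsilon> > 0"
    then obtain K where "(1/4)^K < \<epsilon>"
      using real_arch_pow_inv[of \<epsilon> "1/4"] by auto
    then show "\<exists>N. \<forall>n\<ge>N. norm ((\<integral>x. (S n x - Z x)\<^sup>2 \<partial>M) - 0) < \<epsilon>"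
      using fatou by (intro exI[of _ "r K"]) (force intro: order.strict_trans1)
  qed
  ultimately show ?thesis
    unfolding L2_limit_def using sq by (auto simp: square_integrable_def intro!: exI[of _ Z])
qed

section \<open>Arithmetic of square integrable functions and of their limits\<close>

lemma
  assumes "square_integrable M f" "square_integrable M g"
  shows square_integrable_add: "square_integrable M (\<lambda>x. f x + g x)"
    and square_integrable_minus: "square_integrable M (\<lambda>x. f x - g x)"
proof -
  have [measurable]: "f \<in> borel_measurable M" "g \<in> borel_measurable M"
    using assms by (auto simp: square_integrable_def)
  have "square_integrable M (\<lambda>x. - g x)"
    using assms by (auto simp: square_integrable_def)
  from square_integrable_diff[OF assms(1) this]
  show "square_integrable M (\<lambda>x. f x + g x)"
    by (simp add: square_integrable_def)
  show "square_integrable M (\<lambda>x. f x - g x)"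
    using square_integrable_diff[OF assms] by (simp add: square_integrable_def)
qed

lemma integrable_mult_square_integrable:
  assumes "square_integrable M f" "square_integrable M g"
  shows "integrable M (\<lambda>x. f x * g x)"
proof (rule Bochner_Integration.integrable_bound)
  have [measurable]: "f \<in> borel_measurable M" "g \<in> borel_measurable M"
    using assms by (auto simp: square_integrable_def)
  show "(\<lambda>x. f x * g x) \<in> borel_measurable M"
    by measurable
  show "integrable M (\<lambda>x. (f x)\<^sup>2 + (g x)\<^sup>2)"
    using assms by (auto simp: square_integrable_def)
  have "\<bar>a * b\<bar> \<le> a\<^sup>2 + b\<^sup>2" for a b :: real
  proof -
    have "2 * \<bar>a * b\<bar> \<le> a\<^sup>2 + b\<^sup>2"
      using sum_squares_bound[of "\<bar>a\<bar>" "\<bar>b\<bar>"] by (simp add: abs_mult)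
    then show ?thesis by simp
  qed
  then show "AE x in M. norm (f x * g x) \<le> norm ((f x)\<^sup>2 + (g x)\<^sup>2)"
    by auto
qed

lemma
  assumes "L2_limit M S Z" "L2_limit M S' Z'"
  shows L2_limit_add: "L2_limit M (\<lambda>n x. S n x + S' n x) (\<lambda>x. Z x + Z' x)"
    and L2_limit_minus: "L2_limit M (\<lambda>n x. S n x - S' n x) (\<lambda>x. Z x - Z' x)"
proof -
  have sq: "\<And>n. square_integrable M (S n)" "\<And>n. square_integrable M (S' n)"
    "square_integrable M Z" "square_integrable M Z'"
    using assms by (auto simp: L2_limit_def)
  let ?b = "\<lambda>n. 2 * (\<integral>x. (S n x - Z x)\<^sup>2 \<partial>M) + 2 * (\<integral>x. (S' n x - Z' x)\<^sup>2 \<partial>M)"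
  have b: "?b \<longlonglongrightarrow> 2 * 0 + 2 * 0"
    using assms by (intro tendsto_intros) (auto simp: L2_limit_def)
  \<comment> \<open>\<open>T\<close> stands for the error of the sum or of the difference; both obey
    the same pointwise domination.\<close>
  have le: "(\<integral>x. (T x)\<^sup>2 \<partial>M) \<le> ?b n"
    if "square_integrable M T" "\<And>x. \<bar>T x\<bar> \<le> \<bar>S n x - Z x\<bar> + \<bar>S' n x - Z' x\<bar>" for T n
  proof -
    have "(T x)\<^sup>2 \<le> 2 * (S n x - Z x)\<^sup>2 + 2 * (S' n x - Z' x)\<^sup>2" for x
    proof -
      have "(T x)\<^sup>2 \<le> (\<bar>S n x - Z x\<bar> + \<bar>S' n x - Z' x\<bar>)\<^sup>2"
        using that(2) by (simp add: abs_le_square_iff[symmetric])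
      also have "\<dots> \<le> 2 * \<bar>S n x - Z x\<bar>\<^sup>2 + 2 * \<bar>S' n x - Z' x\<bar>\<^sup>2"
        using sum_squares_bound[of "\<bar>S n x - Z x\<bar>" "\<bar>S' n x - Z' x\<bar>"] by (simp add: power2_sum)
      finally show ?thesis by simp
    qed
    then have "(\<integral>x. (T x)\<^sup>2 \<partial>M) \<le> (\<integral>x. 2 * (S n x - Z x)\<^sup>2 + 2 * (S' n x - Z' x)\<^sup>2 \<partial>M)"
      using that(1) by (intro integral_mono Bochner_Integration.integrable_add integrable_mult_right square_integrable_diff sq)
        (auto simp: square_integrable_def)
    then show ?thesis
      by (simp add: square_integrable_diff sq)
  qed
  have lim: "(\<lambda>n. \<integral>x. (T n x)\<^sup>2 \<partial>M) \<longlonglongrightarrow> 0"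
    if "\<And>n. (\<integral>x. (T n x)\<^sup>2 \<partial>M) \<le> ?b n" for T
    by (rule tendsto_sandwich[OF _ _ tendsto_const b[simplified]]) (use that in auto)
  show "L2_limit M (\<lambda>n x. S n x + S' n x) (\<lambda>x. Z x + Z' x)"
    unfolding L2_limit_def by (intro conjI allI square_integrable_add square_integrable_minus sq lim le) auto
  show "L2_limit M (\<lambda>n x. S n x - S' n x) (\<lambda>x. Z x - Z' x)"
    unfolding L2_limit_def by (intro conjI allI square_integrable_add square_integrable_minus sq lim le) auto
qed

lemma L2_lim_eqI: "\<exists>Z. L2_limit M S Z \<Longrightarrow> L2_limit M S (L2_lim M S)"
  unfolding L2_lim_def by (rule someI_ex[of "L2_limit M S"])

text \<open>Mean square convergence does not control fourth powers, but along a subsequence it gives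
  convergence almost everywhere, and with the uniform bound this is enough for Fatou.\<close>

lemma L2_limit_fourth_moment_le:
  assumes lim: "L2_limit M S Z"
    and int: "\<And>n. integrable M (\<lambda>x. (S n x)^4)"
    and bound: "\<And>n. (\<integral>x. (S n x)^4 \<partial>M) \<le> C"
  shows "integrable M (\<lambda>x. (Z x)^4)" and "(\<integral>x. (Z x)^4 \<partial>M) \<le> C"
proof -
  have sq: "\<And>n. square_integrable M (S n)" "square_integrable M Z"
    and l: "(\<lambda>n. \<integral>x. (S n x - Z x)\<^sup>2 \<partial>M) \<longlonglongrightarrow> 0"
    using lim by (auto simp: L2_limit_def)
  then have [measurable]: "Z \<in> borel_measurable M"
    by (simp add: square_integrable_def)
  obtain r where "AE x in M. (\<lambda>n. (S (r n) x - Z x)\<^sup>2) \<longlonglongrightarrow> 0"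
    using tendsto_L1_AE_subseq[of M "\<lambda>n x. (S n x - Z x)\<^sup>2"] l square_integrable_diff[OF sq]
    by auto
  then have "AE x in M. (\<lambda>n. (S (r n) x)^4) \<longlonglongrightarrow> (Z x)^4"
  proof eventually_elim
    case (elim x)
    then have "(\<lambda>n. S (r n) x - Z x) \<longlonglongrightarrow> 0"
      using tendsto_real_sqrt[OF elim] by (simp add: tendsto_rabs_zero_iff)
    then show ?case
      by (intro tendsto_intros) (simp add: LIM_zero_iff)
  qed
  then show "integrable M (\<lambda>x. (Z x)^4)" and "(\<integral>x. (Z x)^4 \<partial>M) \<le> C"
    using fatou_integral_le[of M "\<lambda>n x. (S (r n) x)^4" "\<lambda>x. (Z x)^4" C] int bound by auto
qed

section \<open>Continuous modifications\<close>

definition dyadic_floor :: "nat \<Rightarrow> real \<Rightarrow> real" where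
  "dyadic_floor n u = real (nat \<lfloor>u * 2^n\<rfloor>) / 2^n"

text \<open>\<open>nat\<close> sends negative floors to 0, hence no condition on \<open>u\<close>;
  moment bounds are available at nonnegative times only.\<close>

lemma dyadic_floor_nonneg: "0 \<le> dyadic_floor n u"
  by (simp add: dyadic_floor_def)

lemma dyadic_floor_close:
  assumes "0 \<le> u"
  shows "\<bar>dyadic_floor n u - u\<bar> \<le> 1 / 2^n"
proof -
  have "real (nat \<lfloor>u * 2^n\<rfloor>) = of_int \<lfloor>u * 2^n\<rfloor>"
    using assms by simp
  then have "real (nat \<lfloor>u * 2^n\<rfloor>) \<le> u * 2^n" "u * 2^n \<le> real (nat \<lfloor>u * 2^n\<rfloor>) + 1"
    by linarith+
  then have "dyadic_floor n u \<le> u" "u \<le> dyadic_floor n u + 1 / 2^n"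
    unfolding dyadic_floor_def by (simp_all add: field_simps)
  then show ?thesis
    by linarith
qed

text \<open>The pathwise half of Kolmogorov's criterion. \<open>m T n\<close> controls the steps of
  level \<open>n\<close> that start in [0, T]; the last one may end beyond \<open>T\<close>. Taking
  the limit along rounded arguments yields a function on the whole half-line at once, in place of an
  extension from the dyadic points.\<close>

lemma dyadic_chaining:
  fixes f :: "real \<Rightarrow> real" and m :: "nat \<Rightarrow> nat \<Rightarrow> real"
  assumes summable: "\<And>T. summable (m T)"
    and incr: "\<And>T n k. k \<le> T * 2^n \<Longrightarrow> \<bar>f (real (Suc k) / 2^n) - f (real k / 2^n)\<bar> \<le> m T n"
  shows "\<And>u. 0 \<le> u \<Longrightarrow> convergent (\<lambda>n. f (dyadic_floor n u))"
    and "continuous_on {0..} (\<lambda>u. lim (\<lambda>n. f (dyadic_floor n u)))"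
proof -
  define a where "a n u = f (dyadic_floor n u)" for n u
  define g where "g u = lim (\<lambda>n. a n u)" for u
  have m_nonneg: "0 \<le> m T n" for T n
    using incr[of 0 T n] by simp
  have index: "nat \<lfloor>u * 2^n\<rfloor> \<le> T * 2^n" if "0 \<le> u" "u \<le> real T" for u T n
  proof -
    have "u * 2^n \<le> real T * 2^n"
      using that by (intro mult_right_mono) auto
    moreover have "real_of_int (int (T * 2^n)) = real T * 2^n"
      by simp
    ultimately have "\<lfloor>u * 2^n\<rfloor> \<le> int (T * 2^n)"
      unfolding floor_le_iff by linarith
    then show ?thesis
      by linarith
  qed
  \<comment> \<open>Refining the grid appends one binary digit: the rounded point stays or moves to
    its right neighbour on the finer grid, at the price of one increment of level
    \<open>Suc n\<close>.\<close>
  have refine: "\<bar>a (Suc n) u - a n u\<bar> \<le> m T (Suc n)" if u: "0 \<le> u" "u \<le> real T" for u T n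
  proof -
    define k where "k = nat \<lfloor>u * 2^n\<rfloor>"
    have k: "k \<le> T * 2^n"
      unfolding k_def using u by (rule index)
    have "real k = of_int \<lfloor>u * 2^n\<rfloor>"
      unfolding k_def using u by simp
    then have "real k \<le> u * 2^n" "u * 2^n < real k + 1"
      by linarith+
    then have "nat \<lfloor>u * 2^Suc n\<rfloor> = 2 * k \<or> nat \<lfloor>u * 2^Suc n\<rfloor> = Suc (2 * k)"
      by (simp add: nat_eq_iff floor_eq_iff) linarith
    then show ?thesis
    proof
      assume "nat \<lfloor>u * 2^Suc n\<rfloor> = 2 * k"
      then have "a (Suc n) u = a n u"
        by (simp add: a_def dyadic_floor_def k_def)
      then show ?thesis
        by (simp add: m_nonneg)
    next
      assume *: "nat \<lfloor>u * 2^Suc n\<rfloor> = Suc (2 * k)"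
      have "a n u = f (real (2 * k) / 2^Suc n)"
        by (simp add: a_def dyadic_floor_def k_def)
      moreover have "a (Suc n) u = f (real (Suc (2 * k)) / 2^Suc n)"
        unfolding a_def dyadic_floor_def * ..
      ultimately show ?thesis
        using incr[of "2 * k" T "Suc n"] k by simp
    qed
  qed
  \<comment> \<open>Points less than one mesh apart round to the same or to adjacent grid
    points.\<close>
  have near: "\<bar>a n v - a n u\<bar> \<le> m T n" if u: "0 \<le> u" "u \<le> v" "v \<le> real T" "v - u < 1 / 2^n" for u v T n
  proof -
    define k where "k = nat \<lfloor>u * 2^n\<rfloor>"
    have k: "k \<le> T * 2^n"
      unfolding k_def using u by (intro index) auto
    have "real k = of_int \<lfloor>u * 2^n\<rfloor>"
      unfolding k_def using u by simp
    then have "real k \<le> u * 2^n" "u * 2^n < real k + 1"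
      by linarith+
    moreover have "u * 2^n \<le> v * 2^n" "v * 2^n < u * 2^n + 1"
      using u by (auto simp: field_simps)
    ultimately have "real k \<le> v * 2^n" "v * 2^n < real k + 2"
      by linarith+
    then have "\<lfloor>v * 2^n\<rfloor> = int k \<or> \<lfloor>v * 2^n\<rfloor> = int k + 1"
      by linarith
    then have "nat \<lfloor>v * 2^n\<rfloor> = k \<or> nat \<lfloor>v * 2^n\<rfloor> = Suc k"
      by linarith
    then show ?thesis
    proof
      assume "nat \<lfloor>v * 2^n\<rfloor> = k"
      then show ?thesis
        by (simp add: a_def dyadic_floor_def k_def m_nonneg)
    next
      assume *: "nat \<lfloor>v * 2^n\<rfloor> = Suc k"
      have "a n v = f (real (Suc k) / 2^n)"
        unfolding a_def dyadic_floor_def * ..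
      then show ?thesis
        using incr[OF k] by (simp add: a_def dyadic_floor_def k_def)
    qed
  qed
  have telescope: "a (n + p) u = a n u + (\<Sum>i<p. a (Suc (n + i)) u - a (n + i) u)" for n p u
    using sum_lessThan_telescope[of "\<lambda>i. a (n + i) u" p] by simp
  have conv: "convergent (\<lambda>n. a n u)" if "0 \<le> u" for u
  proof -
    obtain T :: nat where T: "u \<le> real T"
      using real_arch_simple by blast
    have "summable (\<lambda>n. m T (Suc n))"
      using summable[of T] by (simp add: summable_Suc_iff)
    then have "summable (\<lambda>n. a (Suc n) u - a n u)"
      by (rule summable_comparison_test'[where N = 0]) (use refine that T in simp)
    then have "convergent (\<lambda>p. a 0 u + (\<Sum>i<p. a (Suc i) u - a i u))"
      by (intro convergent_add convergent_const) (simp add: summable_iff_convergent)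
    moreover have "a 0 u + (\<Sum>i<p. a (Suc i) u - a i u) = a p u" for p
      using telescope[of 0 p u] by simp
    ultimately show ?thesis
      by simp
  qed
  then show "convergent (\<lambda>n. f (dyadic_floor n u))" if "0 \<le> u" for u
    using that by (simp add: a_def)
  have tail: "\<bar>g u - a n u\<bar> \<le> (\<Sum>i. m T (i + Suc n))" if u: "0 \<le> u" "u \<le> real T" for u T n
  proof (rule LIMSEQ_le_const2)
    have "(\<lambda>p. a p u) \<longlonglongrightarrow> g u"
      unfolding g_def using conv[OF u(1)] by (simp add: convergent_LIMSEQ_iff)
    then have "(\<lambda>p. a (p + n) u) \<longlonglongrightarrow> g u"
      by (rule LIMSEQ_ignore_initial_segment)
    then show "(\<lambda>p. \<bar>a (n + p) u - a n u\<bar>) \<longlonglongrightarrow> \<bar>g u - a n u\<bar>"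
      by (intro tendsto_intros) (simp add: add.commute)
    have "\<bar>a (n + p) u - a n u\<bar> \<le> (\<Sum>i. m T (i + Suc n))" for p
    proof -
      have "\<bar>a (n + p) u - a n u\<bar> \<le> (\<Sum>i<p. \<bar>a (Suc (n + i)) u - a (n + i) u\<bar>)"
        using telescope[of n p u] by simp
      also have "\<dots> \<le> (\<Sum>i<p. m T (i + Suc n))"
        using refine[OF u] by (intro sum_mono) (simp add: add.commute)
      also have "\<dots> \<le> (\<Sum>i. m T (i + Suc n))"
        using summable[of T] by (intro sum_le_suminf) (simp_all only: summable_iff_shift m_nonneg finite_lessThan)
      finally show ?thesis .
    qed
    then show "\<exists>N. \<forall>p\<ge>N. \<bar>a (n + p) u - a n u\<bar> \<le> (\<Sum>i. m T (i + Suc n))"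
      by blast
  qed
  have "continuous_on {0..} g"
  proof (rule continuous_onI)
    fix u \<epsilon> :: real assume u: "u \<in> {0..}" and "\<epsilon> > 0"
    \<comment> \<open>The margin 1 keeps every \<open>v\<close> with \<open>dist v u < 1\<close> in
      the range governed by the same \<open>m T\<close>.\<close>
    obtain T :: nat where T: "u + 1 \<le> real T"
      using real_arch_simple by blast
    have "\<epsilon> / 3 > 0"
      using \<open>\<epsilon> > 0\<close> by simp
    obtain N1 where N1: "\<And>n. n \<ge> N1 \<Longrightarrow> norm (\<Sum>i. m T (i + n)) < \<epsilon> / 3"
      using suminf_exist_split[OF \<open>\<epsilon> / 3 > 0\<close> summable[of T]] by blast
    obtain N2 where N2: "\<And>n. n \<ge> N2 \<Longrightarrow> norm (m T n) < \<epsilon> / 3"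
      using LIMSEQ_D[OF summable_LIMSEQ_zero[OF summable[of T]] \<open>\<epsilon> / 3 > 0\<close>] by auto
    define n where "n = max N1 N2"
    have R: "(\<Sum>i. m T (i + Suc n)) < \<epsilon> / 3" and m: "m T n < \<epsilon> / 3"
    proof -
      have "N1 \<le> Suc n" "N2 \<le> n"
        by (auto simp: n_def)
      from N1[OF this(1)] N2[OF this(2)] show "(\<Sum>i. m T (i + Suc n)) < \<epsilon> / 3" "m T n < \<epsilon> / 3"
        unfolding real_norm_def by linarith+
    qed
    show "\<exists>d>0. \<forall>v\<in>{0..}. dist v u < d \<longrightarrow> dist (g v) (g u) \<le> \<epsilon>"
    proof (intro exI[of _ "min 1 (1 / 2^n)"] conjI ballI impI)
      fix v assume v: "v \<in> {0..}" and d: "dist v u < min 1 (1 / 2^n)"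
      then have "\<bar>v - u\<bar> < 1" "\<bar>v - u\<bar> < 1 / 2^n"
        unfolding dist_real_def by linarith+
      then have "v \<le> real T"
        using T by linarith
      have "\<bar>a n v - a n u\<bar> \<le> m T n"
        using \<open>\<bar>v - u\<bar> < 1 / 2^n\<close> \<open>v \<le> real T\<close> near[of u v T n] near[of v u T n] u v T by (cases "u \<le> v") (auto simp: abs_minus_commute)
      moreover have "\<bar>g v - a n v\<bar> \<le> (\<Sum>i. m T (i + Suc n))" "\<bar>g u - a n u\<bar> \<le> (\<Sum>i. m T (i + Suc n))"
        using u v T \<open>v \<le> real T\<close> by (intro tail; simp)+
      ultimately show "dist (g v) (g u) \<le> \<epsilon>"
        using R m unfolding dist_real_def by linarith
    qed simp
  qed
  then show "continuous_on {0..} (\<lambda>u. lim (\<lambda>n. f (dyadic_floor n u)))"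
    by (simp add: g_def a_def)
qed

text \<open>On [0, T] there are about T 2^n steps of length 2^-n, each with expected fourth power at
  most C 4^-n. The exponent 2 in the bound beats their number and leaves a geometric decay, which is
  what chaining consumes.\<close>

theorem Kolmogorov_continuity_fourth_moment:
  fixes Y :: "real \<Rightarrow> 'a \<Rightarrow> real"
  assumes meas: "\<And>u. 0 \<le> u \<Longrightarrow> Y u \<in> borel_measurable M"
    and int: "\<And>u v. 0 \<le> u \<Longrightarrow> 0 \<le> v \<Longrightarrow> integrable M (\<lambda>x. (Y u x - Y v x)^4)"
    and bound: "\<And>u v. 0 \<le> u \<Longrightarrow> 0 \<le> v \<Longrightarrow> (\<integral>x. (Y u x - Y v x)^4 \<partial>M) \<le> C * (u - v)\<^sup>2"
  shows "\<exists>Yc :: real \<Rightarrow> 'a \<Rightarrow> real.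
    (\<forall>u\<ge>0. Yc u \<in> borel_measurable M) \<and>
    (\<forall>x\<in>space M. continuous_on {0..} (\<lambda>u. Yc u x)) \<and>
    (\<forall>u\<ge>0. AE x in M. Yc u x = Y u x)"
proof -
  have "0 \<le> (\<integral>x. (Y 1 x - Y 0 x)^4 \<partial>M)"
    by simp
  then have C: "0 \<le> C"
    using order_trans[OF _ bound[of 1 0]] by simp
  \<comment> \<open>\<open>\<bar>d\<bar> \<le> c + d^4 / c^3\<close> with \<open>c = (9/10)^n\<close> dominates the increments of level \<open>n\<close>; the weight
    \<open>c^-3\<close> is harmless because \<open>(10/9)^3 < 2\<close> while the expected fourth powers decay like \<open>2^-n\<close>.\<close>
  define W where "W T n x = (10/9)^(3 * n) * (\<Sum>k\<le>T * 2^n. (Y (real (Suc k) / 2^n) x - Y (real k / 2^n) x)^4)"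
    for T n :: nat and x
  have W_int: "integrable M (W T n)" for T n
    unfolding W_def by (intro integrable_mult_right Bochner_Integration.integrable_sum int) auto
  have W_nonneg: "0 \<le> W T n x" for T n x
    unfolding W_def by (intro mult_nonneg_nonneg sum_nonneg) auto
  \<comment> \<open>The ratio \<open>500/729\<close> is \<open>(10/9)^3 / 2\<close>, the weight
    against the surviving decay.\<close>
  have W_le: "(\<integral>x. W T n x \<partial>M) \<le> C * (real T + 1) * (500/729)^n" for T n
  proof -
    have "(\<integral>x. W T n x \<partial>M)
      = (10/9)^(3 * n) * (\<Sum>k\<le>T * 2^n. \<integral>x. (Y (real (Suc k) / 2^n) x - Y (real k / 2^n) x)^4 \<partial>M)"
      unfolding W_def by (subst integral_mult_right_zero, subst Bochner_Integration.integral_sum) (auto intro!: int)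
    also have "\<dots> \<le> (10/9)^(3 * n) * (\<Sum>k\<le>T * 2^n. C * (real (Suc k) / 2^n - real k / 2^n)\<^sup>2)"
      by (intro mult_left_mono sum_mono bound) auto
    also have "(\<Sum>k\<le>T * 2^n. C * (real (Suc k) / 2^n - real k / 2^n)\<^sup>2) = real (T * 2^n + 1) * (C * (1 / 2^n)\<^sup>2)"
      by (simp flip: diff_divide_distrib)
    also have "\<dots> \<le> ((real T + 1) * 2^n) * (C * (1 / 2^n)\<^sup>2)"
      using C by (intro mult_right_mono) (auto simp: algebra_simps)
    also have "\<dots> = C * (real T + 1) * (1/2)^n"
      by (simp add: power2_eq_square power_one_over)
    also have "(10/9)^(3 * n) * (C * (real T + 1) * (1/2)^n) = C * (real T + 1) * (((10/9)^3)^n * (1/2)^n)"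
      by (simp only: power_mult mult.assoc mult.left_commute)
    also have "((10/9::real)^3)^n * (1/2)^n = (500/729)^n"
      unfolding power_mult_distrib[symmetric] by (rule arg_cong[where f = "\<lambda>z. z^n"]) (simp add: power3_eq_cube)
    finally show ?thesis
      by simp
  qed
  have "AE x in M. summable (\<lambda>n. W T n x)" for T
  proof (rule AE_summable_if_summable_integral[OF W_int W_nonneg])
    show "summable (\<lambda>n. \<integral>x. W T n x \<partial>M)"
    proof (rule summable_comparison_test'[where N = 0])
      show "summable (\<lambda>n. C * (real T + 1) * (500/729)^n)"
        by (intro summable_mult summable_geometric) simp
      show "norm (\<integral>x. W T n x \<partial>M) \<le> C * (real T + 1) * (500/729)^n" for n
        by (subst real_norm_def, subst abs_of_nonneg) (auto intro: integral_nonneg_AE simp: W_nonneg W_le)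
    qed
  qed
  \<comment> \<open>The horizons \<open>T\<close> are natural numbers, so the exceptional sets unite
    into a single null set \<open>N\<close> that does not depend on time.\<close>
  then have "AE x in M. \<forall>T. summable (\<lambda>n. W T n x)"
    by (simp add: AE_all_countable)
  then obtain N where N: "N \<in> null_sets M"
    and W_summable: "\<And>x T. x \<in> space M - N \<Longrightarrow> summable (\<lambda>n. W T n x)"
    by (elim AE_E3) blast
  have [measurable]: "N \<in> sets M"
    using N by auto
  have incr: "\<bar>Y (real (Suc k) / 2^n) x - Y (real k / 2^n) x\<bar> \<le> (9/10)^n + W T n x"
    if "k \<le> T * 2^n" for k T n x
  proof -
    have *: "\<bar>d\<bar> \<le> c + d^4 / c^3" if "c > 0" for c d :: real
    proof (cases "\<bar>d\<bar> \<le> c")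
      case False
      have "c^3 \<le> \<bar>d\<bar>^3"
        using False that by (intro power_mono) auto
      then have "\<bar>d\<bar> * c^3 \<le> \<bar>d\<bar> * \<bar>d\<bar>^3"
        by (intro mult_left_mono) auto
      also have "\<dots> = d^4"
        by (simp add: power3_eq_cube power4_eq_xxxx)
      finally have "\<bar>d\<bar> \<le> d^4 / c^3"
        using that by (simp add: field_simps)
      then show ?thesis
        using that by linarith
    qed (use that in \<open>auto intro: order_trans\<close>)
    have "(Y (real (Suc k) / 2^n) x - Y (real k / 2^n) x)^4
      \<le> (\<Sum>k\<le>T * 2^n. (Y (real (Suc k) / 2^n) x - Y (real k / 2^n) x)^4)"
      using that by (intro member_le_sum[of k "{..T * 2^n}" "\<lambda>k. (Y (real (Suc k) / 2^n) x - Y (real k / 2^n) x)^4"]) auto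
    then have "(10/9)^(3 * n) * (Y (real (Suc k) / 2^n) x - Y (real k / 2^n) x)^4 \<le> W T n x"
      unfolding W_def by (intro mult_left_mono) auto
    moreover have "d / ((9/10)^n)^3 = (10/9)^(3 * n) * d" for d :: real
      by (simp add: power_mult power_divide mult.commute flip: power_mult)
    ultimately show ?thesis
      using *[of "(9/10)^n" "Y (real (Suc k) / 2^n) x - Y (real k / 2^n) x"] by simp
  qed
  \<comment> \<open>Setting the path to 0 on \<open>N\<close> makes continuity hold at every point
    of the space, not just almost everywhere.\<close>
  define Yc where "Yc u x = (if x \<in> N then 0 else lim (\<lambda>n. Y (dyadic_floor n u) x))" for u x
  note chaining = dyadic_chaining[where m = "\<lambda>T n. (9/10)^n + W T n x" and f = "\<lambda>u. Y u x" for x,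
      OF summable_add[OF summable_geometric W_summable] incr]
  show ?thesis
  proof (intro exI[of _ Yc] conjI allI impI ballI)
    fix u :: real assume u: "0 \<le> u"
    have [measurable]: "Y (dyadic_floor n u) \<in> borel_measurable M" for n
      by (intro meas dyadic_floor_nonneg)
    show "Yc u \<in> borel_measurable M"
      unfolding Yc_def by measurable
    \<comment> \<open>At a fixed time the rounded values converge almost everywhere to
      \<open>Y u\<close>, since their expected fourth powers of distance are at most
      \<open>C * (1/4)^n\<close>. This null set depends on \<open>u\<close>, so the result is a
      modification.\<close>
    have "summable (\<lambda>n. \<integral>x. (Y (dyadic_floor n u) x - Y u x)^4 \<partial>M)"
    proof (rule summable_comparison_test'[where N = 0])
      show "summable (\<lambda>n. C * (1/4)^n)"
        by (intro summable_mult summable_geometric) simp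
      fix n
      have "(\<integral>x. (Y (dyadic_floor n u) x - Y u x)^4 \<partial>M) \<le> C * \<bar>dyadic_floor n u - u\<bar>\<^sup>2"
        using bound[OF dyadic_floor_nonneg u] by simp
      also have "\<dots> \<le> C * (1 / 2^n)\<^sup>2"
        using C dyadic_floor_close[OF u] by (intro mult_left_mono power_mono) auto
      also have "(1 / 2^n)\<^sup>2 = (1/4::real)^n"
        by (simp add: power_divide power2_eq_square flip: power_mult_distrib)
      finally show "norm (\<integral>x. (Y (dyadic_floor n u) x - Y u x)^4 \<partial>M) \<le> C * (1/4)^n"
        by (subst real_norm_def, subst abs_of_nonneg) auto
    qed
    then have "AE x in M. summable (\<lambda>n. (Y (dyadic_floor n u) x - Y u x)^4)"
      by (intro AE_summable_if_summable_integral int dyadic_floor_nonneg u) auto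
    moreover have "AE x in M. x \<notin> N"
      using N by (rule AE_not_in)
    ultimately show "AE x in M. Yc u x = Y u x"
    proof eventually_elim
      case (elim x)
      have "(\<lambda>n. Y (dyadic_floor n u) x - Y u x) \<longlonglongrightarrow> 0"
        using summable_LIMSEQ_zero[OF elim(1)] by simp
      then show ?case
        using elim(2) by (simp add: Yc_def limI LIM_zero_iff)
    qed
  next
    fix x assume x: "x \<in> space M"
    show "continuous_on {0..} (\<lambda>u. Yc u x)"
    proof (cases "x \<in> N")
      case False
      then show ?thesis
        using chaining(2)[of x] x by (simp add: Yc_def)
    qed (simp add: Yc_def)
  qed
qed

text \<open>The process is run by a clock in which the increments are controlled by elapsed time.
  \<open>H\<close> may be bounded and constant on intervals, so it cannot itself serve as an
  invertible clock.\<close>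

theorem Kolmogorov_continuity_time_change:
  fixes Z :: "real \<Rightarrow> 'a \<Rightarrow> real" and H :: "real \<Rightarrow> real"
  assumes meas: "\<And>t. 0 \<le> t \<Longrightarrow> Z t \<in> borel_measurable M"
    and int: "\<And>s t. 0 \<le> s \<Longrightarrow> s \<le> t \<Longrightarrow> integrable M (\<lambda>x. (Z t x - Z s x)^4)"
    and bound: "\<And>s t. 0 \<le> s \<Longrightarrow> s \<le> t \<Longrightarrow> (\<integral>x. (Z t x - Z s x)^4 \<partial>M) \<le> C * (H t - H s)\<^sup>2"
    and C: "0 \<le> C"
    and cont: "continuous_on {0..} H"
    and mono: "\<And>s t. 0 \<le> s \<Longrightarrow> s \<le> t \<Longrightarrow> H s \<le> H t"
  shows "\<exists>Zc :: real \<Rightarrow> 'a \<Rightarrow> real.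
    (\<forall>t\<ge>0. Zc t \<in> borel_measurable M) \<and>
    (\<forall>x\<in>space M. continuous_on {0..} (\<lambda>t. Zc t x)) \<and>
    (\<forall>t\<ge>0. AE x in M. Zc t x = Z t x)"
proof -
  \<comment> \<open>Adding the identity to \<open>H\<close> makes it a bijection of the half-line.\<close>
  define V where "V t = t + (H t - H 0)" for t
  have V_cont: "continuous_on {0..} V"
    unfolding V_def by (intro continuous_intros cont)
  have V_diff: "t - s \<le> V t - V s" "H t - H s \<le> V t - V s" if "0 \<le> s" "s \<le> t" for s t
    using mono[OF that] that by (auto simp: V_def)
  have V_inj: "s = t" if "V s = V t" "0 \<le> s" "0 \<le> t" for s t
  proof (rule linorder_le_cases[of s t])
    assume "s \<le> t"
    then show ?thesis
      using V_diff(1)[OF that(2)] that(1) by fastforce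
  next
    assume "t \<le> s"
    then show ?thesis
      using V_diff(1)[OF that(3)] that(1) by fastforce
  qed
  have V_nonneg: "0 \<le> V t" if "0 \<le> t" for t
    using V_diff(1)[of 0 t] that by (simp add: V_def)
  have "\<exists>t\<ge>0. V t = u" if "0 \<le> u" for u
  proof -
    have "V 0 \<le> u" "u \<le> V u"
      using V_diff(1)[of 0 u] that by (auto simp: V_def)
    moreover have "continuous_on {0..u} V"
      by (rule continuous_on_subset[OF V_cont]) auto
    ultimately have "\<exists>t\<ge>0. t \<le> u \<and> V t = u"
      using that by (intro IVT')
    then show ?thesis
      by blast
  qed
  \<comment> \<open>\<open>\<tau>\<close> is merely a right inverse chosen pointwise; the moment
    bound for \<open>Z (\<tau> u)\<close> uses only \<open>V (\<tau> u) = u\<close>, and continuity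
    in \<open>t\<close> returns by composing with the continuous \<open>V\<close>.\<close>
  then obtain \<tau> where \<tau>: "\<And>u. 0 \<le> u \<Longrightarrow> 0 \<le> \<tau> u" "\<And>u. 0 \<le> u \<Longrightarrow> V (\<tau> u) = u"
    by metis
  have \<tau>_V: "\<tau> (V t) = t" if "0 \<le> t" for t
    using V_inj[OF \<tau>(2)[OF V_nonneg[OF that]] \<tau>(1)[OF V_nonneg[OF that]] that] .
  have incr: "integrable M (\<lambda>x. (Z t x - Z s x)^4) \<and>
      (\<integral>x. (Z t x - Z s x)^4 \<partial>M) \<le> C * (V t - V s)\<^sup>2"
    if "0 \<le> s" "s \<le> t" for s t
  proof -
    have "C * (H t - H s)\<^sup>2 \<le> C * (V t - V s)\<^sup>2"
      using mono[OF that] V_diff[OF that] C by (intro mult_left_mono power_mono) auto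
    then show ?thesis
      using int[OF that] bound[OF that] by linarith
  qed
  have "integrable M (\<lambda>x. (Z (\<tau> u) x - Z (\<tau> v) x)^4) \<and>
      (\<integral>x. (Z (\<tau> u) x - Z (\<tau> v) x)^4 \<partial>M) \<le> C * (u - v)\<^sup>2" if "0 \<le> u" "0 \<le> v" for u v
  proof (cases "\<tau> v \<le> \<tau> u")
    case True
    show ?thesis
      using incr[OF \<tau>(1)[OF that(2)] True] unfolding \<tau>(2)[OF that(1)] \<tau>(2)[OF that(2)] .
  next
    case False
    have "(p - q)^4 = (q - p)^4" for p q :: real
      by (simp add: power4_eq_xxxx algebra_simps)
    then have swap: "(\<lambda>x. (Z (\<tau> u) x - Z (\<tau> v) x)^4) = (\<lambda>x. (Z (\<tau> v) x - Z (\<tau> u) x)^4)"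
      by blast
    have "\<tau> u \<le> \<tau> v"
      using False by simp
    from incr[OF \<tau>(1)[OF that(1)] this] show ?thesis
      unfolding \<tau>(2)[OF that(1)] \<tau>(2)[OF that(2)] swap power2_commute[of u v] .
  qed
  then have "\<exists>Yc :: real \<Rightarrow> 'a \<Rightarrow> real.
    (\<forall>u\<ge>0. Yc u \<in> borel_measurable M) \<and>
    (\<forall>x\<in>space M. continuous_on {0..} (\<lambda>u. Yc u x)) \<and>
    (\<forall>u\<ge>0. AE x in M. Yc u x = Z (\<tau> u) x)"
    by (intro Kolmogorov_continuity_fourth_moment[of "\<lambda>u. Z (\<tau> u)" M C] meas \<tau>(1); blast)
  then obtain Yc :: "real \<Rightarrow> 'a \<Rightarrow> real" where
    "(\<forall>u\<ge>0. Yc u \<in> borel_measurable M) \<and>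
    (\<forall>x\<in>space M. continuous_on {0..} (\<lambda>u. Yc u x)) \<and>
    (\<forall>u\<ge>0. AE x in M. Yc u x = Z (\<tau> u) x)"
    by (rule exE)
  then have Yc: "\<And>u. 0 \<le> u \<Longrightarrow> Yc u \<in> borel_measurable M"
    "\<And>x. x \<in> space M \<Longrightarrow> continuous_on {0..} (\<lambda>u. Yc u x)"
    "\<And>u. 0 \<le> u \<Longrightarrow> AE x in M. Yc u x = Z (\<tau> u) x"
    by simp_all
  show ?thesis
  proof (intro exI[of _ "\<lambda>t. Yc (V t)"] conjI allI impI ballI)
    show "continuous_on {0..} (\<lambda>t. Yc (V t) x)" if "x \<in> space M" for x
      by (rule continuous_on_compose2[OF Yc(2)[OF that] V_cont]) (use V_nonneg in auto)
    show "AE x in M. Yc (V t) x = Z t x" if "0 \<le> t" for t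
      using Yc(3)[OF V_nonneg[OF that]] \<tau>_V[OF that] by simp
  qed (use Yc(1) V_nonneg in auto)
qed

section \<open>Fourth moments of quadratic forms in independent variables\<close>

lemma L2_Cauchy_Schwarz:
  assumes f: "square_integrable M f" and g: "square_integrable M g"
  shows "(\<integral>x. f x * g x \<partial>M)\<^sup>2 \<le> (\<integral>x. (f x)\<^sup>2 \<partial>M) * (\<integral>x. (g x)\<^sup>2 \<partial>M)"
proof -
  define a b c where "a = (\<integral>x. (f x)\<^sup>2 \<partial>M)" and "b = (\<integral>x. f x * g x \<partial>M)"
    and "c = (\<integral>x. (g x)\<^sup>2 \<partial>M)"
  have [simp]: "integrable M (\<lambda>x. (f x)\<^sup>2)" "integrable M (\<lambda>x. (g x)\<^sup>2)"
    "integrable M (\<lambda>x. f x * g x)"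
    using f g integrable_mult_square_integrable[OF f g] by (auto simp: square_integrable_def)
  have *: "0 \<le> a - 2 * t * b + t\<^sup>2 * c" for t
  proof -
    have "0 \<le> (\<integral>x. (f x - t * g x)\<^sup>2 \<partial>M)"
      by simp
    also have "\<dots> = (\<integral>x. (f x)\<^sup>2 - 2 * t * (f x * g x) + t\<^sup>2 * (g x)\<^sup>2 \<partial>M)"
      by (intro Bochner_Integration.integral_cong) (auto simp: power2_eq_square algebra_simps)
    also have "\<dots> = a - 2 * t * b + t\<^sup>2 * c"
      by (simp add: a_def b_def c_def)
    finally show ?thesis .
  qed
  have "c \<ge> 0"
    by (simp add: c_def)
  have "b\<^sup>2 \<le> a * c"
  proof (cases "c = 0")
    case True
    have "b = 0"
    proof (rule ccontr)
      assume "b \<noteq> 0"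
      then show False
        \<comment> \<open>For \<open>c = 0\<close> the quadratic polynomial is affine in
          \<open>t\<close>; this \<open>t\<close> gives it the value -1.\<close>
        using *[of "(a + 1) / (2 * b)"] True by simp
    qed
    then show ?thesis
      using True by simp
  next
    case False
    with \<open>c \<ge> 0\<close> have "c > 0" by simp
    then show ?thesis
      using *[of "b / c"] by (simp add: power2_eq_square field_simps)
  qed
  then show ?thesis
    by (simp add: a_def b_def c_def)
qed

text \<open>A class closed under sums and products, so that integrability of any polynomial in the
  coordinates follows by syntax alone. The power \<open>p = 0\<close> confines it to finite
  measures.\<close>

definition all_moments :: "'a measure \<Rightarrow> ('a \<Rightarrow> real) \<Rightarrow> bool" where
  "all_moments M f \<longleftrightarrow> f \<in> borel_measurable M \<and> (\<forall>p::nat. integrable M (\<lambda>x. \<bar>f x\<bar> ^ p))"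

lemma all_moments_measurable [measurable_dest]: "all_moments M f \<Longrightarrow> f \<in> borel_measurable M"
  by (simp add: all_moments_def)

lemma all_moments_add:
  assumes "all_moments M f" "all_moments M g"
  shows "all_moments M (\<lambda>x. f x + g x)"
  unfolding all_moments_def
proof (intro conjI allI)
  note [measurable] = assms
  show "(\<lambda>x. f x + g x) \<in> borel_measurable M"
    by measurable
  fix p :: nat
  show "integrable M (\<lambda>x. \<bar>f x + g x\<bar> ^ p)"
  proof (rule Bochner_Integration.integrable_bound)
    show "integrable M (\<lambda>x. 2^p * (\<bar>f x\<bar> ^ p + \<bar>g x\<bar> ^ p))"
      using assms by (auto simp: all_moments_def)
    have "\<bar>a + b\<bar> ^ p \<le> 2^p * (\<bar>a\<bar> ^ p + \<bar>b\<bar> ^ p)" for a b :: real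
    proof -
      have "\<bar>a + b\<bar> ^ p \<le> (2 * max \<bar>a\<bar> \<bar>b\<bar>) ^ p"
        by (intro power_mono) auto
      also have "\<dots> \<le> 2^p * (\<bar>a\<bar> ^ p + \<bar>b\<bar> ^ p)"
        by (auto simp: power_mult_distrib max_def)
      finally show ?thesis .
    qed
    then show "AE x in M. norm (\<bar>f x + g x\<bar> ^ p) \<le> norm (2^p * (\<bar>f x\<bar> ^ p + \<bar>g x\<bar> ^ p))"
      by (simp add: add_nonneg_nonneg)
  qed measurable
qed

text \<open>Doubling the exponent does it: moments of order \<open>2 * p\<close> of the factors make
  their \<open>p\<close>-th powers square integrable.\<close>

lemma all_moments_mult:
  assumes "all_moments M f" "all_moments M g"
  shows "all_moments M (\<lambda>x. f x * g x)"
  unfolding all_moments_def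
proof (intro conjI allI)
  note [measurable] = assms
  show "(\<lambda>x. f x * g x) \<in> borel_measurable M"
    by measurable
  fix p :: nat
  have "square_integrable M (\<lambda>x. \<bar>f x\<bar> ^ p)" "square_integrable M (\<lambda>x. \<bar>g x\<bar> ^ p)"
    using assms by (auto simp: all_moments_def square_integrable_def simp flip: power_mult)
  from integrable_mult_square_integrable[OF this] show "integrable M (\<lambda>x. \<bar>f x * g x\<bar> ^ p)"
    by (simp add: abs_mult power_mult_distrib)
qed

lemma (in finite_measure) all_moments_const: "all_moments M (\<lambda>_. c)"
  by (simp add: all_moments_def)

lemma (in finite_measure) all_moments_sum:
  "(\<And>i. i \<in> I \<Longrightarrow> all_moments M (f i)) \<Longrightarrow> all_moments M (\<lambda>x. \<Sum>i\<in>I. f i x)"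
  by (induction I rule: infinite_finite_induct) (auto intro: all_moments_add all_moments_const)

lemma (in finite_measure) all_moments_power:
  "all_moments M f \<Longrightarrow> all_moments M (\<lambda>x. f x ^ n)"
  by (induction n) (auto intro: all_moments_mult all_moments_const)

lemma (in finite_measure) all_moments_diff:
  assumes "all_moments M f" "all_moments M g"
  shows "all_moments M (\<lambda>x. f x - g x)"
  using all_moments_add[OF assms(1) all_moments_mult[OF all_moments_const[of "-1"] assms(2)]] by simp

lemmas (in finite_measure) all_moments_intros =
  all_moments_add all_moments_diff all_moments_mult all_moments_const all_moments_sum all_moments_power

lemma all_moments_integrable:
  assumes "all_moments M f"
  shows "integrable M f"
proof -
  note [measurable] = assms
  have "integrable M (\<lambda>x. \<bar>f x\<bar> ^ 1)"
    using assms unfolding all_moments_def by blast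
  then show ?thesis
    by (simp add: integrable_abs_iff)
qed

lemma (in finite_measure) all_moments_square_integrable:
  "all_moments M f \<Longrightarrow> square_integrable M f"
  unfolding square_integrable_def
  by (auto intro!: all_moments_integrable all_moments_intros)

text \<open>The differences need only be orthogonal to the cube of the preceding partial sum; then
  Cauchy--Schwarz bounds the mixed term of the binomial expansion by the two fourth moments.\<close>

lemma (in prob_space) fourth_moment_sum_le:
  fixes D :: "nat \<Rightarrow> 'a \<Rightarrow> real"
  assumes D: "\<And>n. all_moments M (D n)"
    and orth: "\<And>n. (\<integral>x. (\<Sum>k<n. D k x)^3 * D n x \<partial>M) = 0"
    and D4: "\<And>n. (\<integral>x. (D n x)^4 \<partial>M) \<le> (c * s n)\<^sup>2"
    and c: "c \<ge> 0" and s: "\<And>n. s n \<ge> 0"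
  shows "(\<integral>x. (\<Sum>k<n. D k x)^4 \<partial>M) \<le> (4 * c * (\<Sum>k<n. s k))\<^sup>2"
proof (induction n)
  case (Suc n)
  define Q where "Q x = (\<Sum>k<n. D k x)" for x
  define A where "A = (\<Sum>k<n. s k)"
  have Q: "all_moments M Q"
    unfolding Q_def by (intro all_moments_intros D)
  have A: "A \<ge> 0"
    unfolding A_def by (intro sum_nonneg s)
  note int = all_moments_integrable all_moments_intros Q D
  have Q4: "(\<integral>x. (Q x)^4 \<partial>M) \<le> (4 * c * A)\<^sup>2"
    using Suc unfolding Q_def A_def .
  have "(\<integral>x. (Q x)\<^sup>2 * (D n x)\<^sup>2 \<partial>M)\<^sup>2
      \<le> (\<integral>x. ((Q x)\<^sup>2)\<^sup>2 \<partial>M) * (\<integral>x. ((D n x)\<^sup>2)\<^sup>2 \<partial>M)"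
    by (intro L2_Cauchy_Schwarz all_moments_square_integrable int)
  also have "\<dots> \<le> (4 * c * A)\<^sup>2 * (c * s n)\<^sup>2"
    using Q4 D4[of n] by (intro mult_mono) (simp_all flip: power_mult)
  also have "\<dots> = ((4 * c * A) * (c * s n))\<^sup>2"
    by (simp add: power_mult_distrib)
  finally have mixed: "(\<integral>x. (Q x)\<^sup>2 * (D n x)\<^sup>2 \<partial>M) \<le> (4 * c * A) * (c * s n)"
    by (rule power2_le_imp_le) (use A c s in simp)
  \<comment> \<open>\<open>q^3 * d\<close> is kept because its integral vanishes. For
    \<open>4 * q * d^3\<close> orthogonality gives nothing, so it is absorbed by
    \<open>2 * q^2 * d^2 + 2 * d^4\<close>.\<close>
  have pt: "(q + d)^4 \<le> q^4 + 4 * (q^3 * d) + 8 * (q\<^sup>2 * d\<^sup>2) + 3 * d^4" for q d :: real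
  proof -
    have "0 \<le> 2 * (d * (q - d))\<^sup>2"
      by simp
    also have "\<dots> = q^4 + 4 * (q^3 * d) + 8 * (q\<^sup>2 * d\<^sup>2) + 3 * d^4 - (q + d)^4"
      by (simp add: power2_eq_square power3_eq_cube power4_eq_xxxx algebra_simps)
    finally show ?thesis by simp
  qed
  have "(\<integral>x. (\<Sum>k<Suc n. D k x)^4 \<partial>M)
      \<le> (\<integral>x. (Q x)^4 + 4 * ((Q x)^3 * D n x) + 8 * ((Q x)\<^sup>2 * (D n x)\<^sup>2) + 3 * (D n x)^4 \<partial>M)"
    unfolding sum.lessThan_Suc Q_def[symmetric] by (intro integral_mono pt int)
  also have "\<dots> = (\<integral>x. (Q x)^4 \<partial>M) + 4 * (\<integral>x. (Q x)^3 * D n x \<partial>M)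
      + 8 * (\<integral>x. (Q x)\<^sup>2 * (D n x)\<^sup>2 \<partial>M) + 3 * (\<integral>x. (D n x)^4 \<partial>M)"
    by (subst Bochner_Integration.integral_add, (intro int)+)+ simp
  also have "\<dots> \<le> (4 * c * A)\<^sup>2 + 8 * ((4 * c * A) * (c * s n)) + 3 * (c * s n)\<^sup>2"
    using Q4 mixed D4[of n] orth[of n] unfolding Q_def by linarith
  \<comment> \<open>This fixes the constant 4 of the statement: the mixed terms agree exactly, as 8
    * 4 = 2 * 4^2, and 16 - 3 = 13 is left over.\<close>
  also have "\<dots> = (4 * c * (A + s n))\<^sup>2 - 13 * (c * s n)\<^sup>2"
    by (simp add: power2_eq_square algebra_simps)
  also have "\<dots> \<le> (4 * c * (\<Sum>k<Suc n. s k))\<^sup>2"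
    by (simp add: A_def)
  finally show ?case .
qed simp

text \<open>The eighth moments are there because \<open>(X n)^2 - 1\<close> is raised to the fourth
  power. \<open>\<kappa> \<ge> 1\<close> allows lower powers of \<open>\<kappa>\<close> to be
  replaced by higher ones.\<close>

locale standardized_independent = prob_space +
  fixes X :: "nat \<Rightarrow> 'a \<Rightarrow> real" and \<kappa> :: real
  assumes indep: "indep_vars (\<lambda>_. borel) X UNIV"
    and moments: "\<And>n. all_moments M (X n)"
    and mean: "\<And>n. (\<integral>x. X n x \<partial>M) = 0"
    and variance: "\<And>n. (\<integral>x. (X n x)\<^sup>2 \<partial>M) = 1"
    and fourth: "\<And>n. (\<integral>x. (X n x)^4 \<partial>M) \<le> \<kappa>"
    and eighth: "\<And>n. (\<integral>x. (X n x)^8 \<partial>M) \<le> \<kappa>"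
    and \<kappa>: "\<kappa> \<ge> 1"
begin

text \<open>This replaces conditional expectations: a factor that depends on the past only splits
  off by independence. The past has to be presented as a function \<open>F\<close> of the restricted
  tuple, whereas \<open>f\<close> is the same variable in its readable form.\<close>

lemma integral_past_times_new:
  fixes F :: "(nat \<Rightarrow> real) \<Rightarrow> real" and G :: "real \<Rightarrow> real"
  assumes F: "F \<in> borel_measurable (PiM {..<n} (\<lambda>_. borel))" and G: "G \<in> borel_measurable borel"
    and f: "\<And>x. F (\<lambda>k\<in>{..<n}. X k x) = f x"
    and int: "integrable M f" "integrable M (\<lambda>x. G (X n x))"
  shows "(\<integral>x. f x * G (X n x) \<partial>M) = (\<integral>x. f x \<partial>M) * (\<integral>x. G (X n x) \<partial>M)"
proof -
  have "indep_var
    borel (F \<circ> (\<lambda>\<omega>. restrict (\<lambda>i. X i \<omega>) {..<n}))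
    borel ((\<lambda>y. G (y n)) \<circ> (\<lambda>\<omega>. restrict (\<lambda>i. X i \<omega>) {n}))"
    using G by (intro indep_var_compose[OF indep_var_restrict[OF indep]] F) auto
  then have "indep_var borel f borel (\<lambda>x. G (X n x))"
    by (simp add: comp_def f)
  from indep_var_lebesgue_integral[OF this int] show ?thesis .
qed

text \<open>Needed for the coefficient of \<open>X n\<close> in a quadratic form, which is a linear
  form in the earlier variables.\<close>

lemma linear_form_fourth_moment:
  "(\<integral>x. (\<Sum>k<n. a k * X k x)^4 \<partial>M) \<le> (4 * \<kappa> * (\<Sum>k<n. (a k)\<^sup>2))\<^sup>2"
proof (rule fourth_moment_sum_le)
  fix n
  note int = all_moments_integrable all_moments_intros moments
  show "all_moments M (\<lambda>x. a n * X n x)"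
    by (intro int)
  have "(\<integral>x. (\<Sum>k<n. a k * X k x)^3 * (a n * X n x) \<partial>M)
      = (\<integral>x. (\<Sum>k<n. a k * X k x)^3 \<partial>M) * (\<integral>x. a n * X n x \<partial>M)"
    by (rule integral_past_times_new[where F = "\<lambda>y. (\<Sum>k<n. a k * y k)^3" and G = "\<lambda>z. a n * z"])
      (auto intro!: int)
  then show "(\<integral>x. (\<Sum>k<n. a k * X k x)^3 * (a n * X n x) \<partial>M) = 0"
    by (simp add: mean)
  have "(\<integral>x. (a n * X n x)^4 \<partial>M) = (a n)^4 * (\<integral>x. (X n x)^4 \<partial>M)"
    by (simp add: power_mult_distrib)
  also have "\<dots> \<le> (a n)^4 * \<kappa>\<^sup>2"
    using fourth[of n] \<kappa> by (intro mult_left_mono) (auto simp: power2_eq_square intro: order_trans)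
  also have "\<dots> = (\<kappa> * (a n)\<^sup>2)\<^sup>2"
    by (simp add: power_mult_distrib)
  finally show "(\<integral>x. (a n * X n x)^4 \<partial>M) \<le> (\<kappa> * (a n)\<^sup>2)\<^sup>2" .
qed (use \<kappa> in auto)

text \<open>The summand \<open>j\<close> is exactly what is revealed with \<open>X j\<close>.
  Off-diagonal and diagonal coefficients are independent parameters because they will come from
  different kernels.\<close>

definition quadratic_form :: "(nat \<Rightarrow> nat \<Rightarrow> real) \<Rightarrow> (nat \<Rightarrow> real) \<Rightarrow> nat \<Rightarrow> 'a \<Rightarrow> real" where
  "quadratic_form a b n x = (\<Sum>j<n. (\<Sum>k<j. a j k * X k x) * X j x + b j * ((X j x)\<^sup>2 - 1))"

lemma all_moments_quadratic_form: "all_moments M (quadratic_form a b n)"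
  unfolding quadratic_form_def by (intro all_moments_intros moments)

text \<open>Each summand consists of past factors times centred functions of the new variable, hence
  is orthogonal to the cube of the preceding sum. The constant 48 is 4 from the inequality for sums
  times 12 from a single summand.\<close>

lemma quadratic_form_fourth_moment:
  "(\<integral>x. (quadratic_form a b n x)^4 \<partial>M)
    \<le> (48 * \<kappa>\<^sup>2 * (\<Sum>j<n. (\<Sum>k<j. (a j k)\<^sup>2) + (b j)\<^sup>2))\<^sup>2"
proof -
  note int = all_moments_integrable all_moments_intros moments
  let ?L = "\<lambda>n x. \<Sum>k<n. a n k * X k x"
  have "(\<integral>x. (\<Sum>j<n. ?L j x * X j x + b j * ((X j x)\<^sup>2 - 1))^4 \<partial>M)
    \<le> (4 * (12 * \<kappa>\<^sup>2) * (\<Sum>j<n. (\<Sum>k<j. (a j k)\<^sup>2) + (b j)\<^sup>2))\<^sup>2"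
  proof (rule fourth_moment_sum_le)
    fix n
    show "all_moments M (\<lambda>x. ?L n x * X n x + b n * ((X n x)\<^sup>2 - 1))"
      by (intro int)
    let ?Q = "\<lambda>x. \<Sum>j<n. ?L j x * X j x + b j * ((X j x)\<^sup>2 - 1)"
    let ?F = "\<lambda>y. \<Sum>j<n. (\<Sum>k<j. a j k * y k) * y j + b j * ((y j)\<^sup>2 - 1)"
    have F: "?F \<in> borel_measurable (PiM {..<n} (\<lambda>_. borel))"
      by (intro borel_measurable_sum borel_measurable_add borel_measurable_times borel_measurable_power
          borel_measurable_diff borel_measurable_const measurable_component_singleton) auto
    have F': "(\<lambda>y. \<Sum>k<n. a n k * y k) \<in> borel_measurable (PiM {..<n} (\<lambda>_. borel))"
      by (intro borel_measurable_sum borel_measurable_times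
          borel_measurable_const measurable_component_singleton) auto
    \<comment> \<open>The restricted tuple is \<open>undefined\<close> from index \<open>n\<close>
      on; only indices below \<open>j \<le> n\<close> are read.\<close>
    have LX: "(\<Sum>k<j. a j k * (\<lambda>k\<in>{..<n}. X k x) k) = ?L j x" if "j \<le> n" for j x
      by (rule sum.cong) (use that in auto)
    have FX: "?F (\<lambda>k\<in>{..<n}. X k x) = ?Q x" for x
    proof (rule sum.cong)
      fix j assume "j \<in> {..<n}"
      then show "(\<Sum>k<j. a j k * (\<lambda>k\<in>{..<n}. X k x) k) * (\<lambda>k\<in>{..<n}. X k x) j
          + b j * (((\<lambda>k\<in>{..<n}. X k x) j)\<^sup>2 - 1)
        = ?L j x * X j x + b j * ((X j x)\<^sup>2 - 1)"
        by (subst LX) auto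
    qed simp
    \<comment> \<open>The coefficient \<open>?L n\<close> belongs to the past too and is grouped
      with the cube.\<close>
    have 1: "(\<integral>x. ((?Q x)^3 * ?L n x) * X n x \<partial>M) = (\<integral>x. (?Q x)^3 * ?L n x \<partial>M) * (\<integral>x. X n x \<partial>M)"
      by (rule integral_past_times_new[where F = "\<lambda>y. (?F y)^3 * (\<Sum>k<n. a n k * y k)" and G = "\<lambda>z. z"])
        (intro borel_measurable_times borel_measurable_power F F', simp, simp only: FX LX order_refl, (intro int)+)
    have 2: "(\<integral>x. (?Q x)^3 * (b n * ((X n x)\<^sup>2 - 1)) \<partial>M)
        = (\<integral>x. (?Q x)^3 \<partial>M) * (\<integral>x. b n * ((X n x)\<^sup>2 - 1) \<partial>M)"
      by (rule integral_past_times_new[where F = "\<lambda>y. (?F y)^3" and G = "\<lambda>z. b n * (z\<^sup>2 - 1)"])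
        (intro borel_measurable_power F, simp, simp only: FX, (intro int)+)
    have 3: "(\<integral>x. b n * ((X n x)\<^sup>2 - 1) \<partial>M) = 0"
    proof -
      have "integrable M (\<lambda>x. (X n x)\<^sup>2)"
        by (intro int)
      then show ?thesis
        by (simp add: variance prob_space)
    qed
    have "(\<integral>x. (?Q x)^3 * (?L n x * X n x + b n * ((X n x)\<^sup>2 - 1)) \<partial>M)
      = (\<integral>x. ((?Q x)^3 * ?L n x) * X n x + (?Q x)^3 * (b n * ((X n x)\<^sup>2 - 1)) \<partial>M)"
      by (simp only: distrib_left mult.assoc)
    also have "\<dots> = (\<integral>x. ((?Q x)^3 * ?L n x) * X n x \<partial>M) + (\<integral>x. (?Q x)^3 * (b n * ((X n x)\<^sup>2 - 1)) \<partial>M)"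
      by (intro Bochner_Integration.integral_add int)
    also have "\<dots> = 0"
      unfolding 1 2 3 mean by simp
    finally show "(\<integral>x. (?Q x)^3 * (?L n x * X n x + b n * ((X n x)\<^sup>2 - 1)) \<partial>M) = 0" .
    define s where "s = (\<Sum>k<n. (a n k)\<^sup>2)"
    have s: "s \<ge> 0"
      by (simp add: s_def sum_nonneg)
    have sum4: "(u + v)^4 \<le> 8 * (u^4 + v^4)" for u v :: real
    proof -
      have "(u + v)\<^sup>2 \<le> 2 * (u\<^sup>2 + v\<^sup>2)"
        using sum_squares_bound[of u v] by (simp add: power2_sum)
      then have "((u + v)\<^sup>2)\<^sup>2 \<le> (2 * (u\<^sup>2 + v\<^sup>2))\<^sup>2"
        by (intro power_mono) auto
      also have "\<dots> \<le> 8 * ((u\<^sup>2)\<^sup>2 + (v\<^sup>2)\<^sup>2)"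
        using sum_squares_bound[of "u\<^sup>2" "v\<^sup>2"] by (simp add: power2_sum power_mult_distrib)
      finally show ?thesis
        by (simp flip: power_mult)
    qed
    have pt: "(l * x + c * (x\<^sup>2 - 1))^4 \<le> 8 * (l^4 * x^4) + 64 * c^4 * (x^8 + 1)" for l x c :: real
    proof -
      have "(x\<^sup>2 - 1)^4 \<le> 8 * (x^8 + 1)"
        using sum4[of "x\<^sup>2" "-1"] by (simp flip: power_mult)
      then have "c^4 * (x\<^sup>2 - 1)^4 \<le> c^4 * (8 * (x^8 + 1))"
        by (intro mult_left_mono) auto
      then show ?thesis
        using sum4[of "l * x" "c * (x\<^sup>2 - 1)"] unfolding power_mult_distrib distrib_left by linarith
    qed
    have 4: "(\<integral>x. (?L n x)^4 * (X n x)^4 \<partial>M) = (\<integral>x. (?L n x)^4 \<partial>M) * (\<integral>x. (X n x)^4 \<partial>M)"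
      by (rule integral_past_times_new[where F = "\<lambda>y. (\<Sum>k<n. a n k * y k)^4" and G = "\<lambda>z. z^4"])
        (intro borel_measurable_power F', simp, simp only: LX order_refl, (intro int)+)
    have "(\<integral>x. (?L n x * X n x + b n * ((X n x)\<^sup>2 - 1))^4 \<partial>M)
      \<le> (\<integral>x. 8 * ((?L n x)^4 * (X n x)^4) + 64 * (b n)^4 * ((X n x)^8 + 1) \<partial>M)"
      by (intro integral_mono pt int)
    also have "\<dots> = (\<integral>x. 8 * ((?L n x)^4 * (X n x)^4) \<partial>M) + (\<integral>x. 64 * (b n)^4 * ((X n x)^8 + 1) \<partial>M)"
      by (intro Bochner_Integration.integral_add int)
    also have "(\<integral>x. 8 * ((?L n x)^4 * (X n x)^4) \<partial>M) = 8 * ((\<integral>x. (?L n x)^4 \<partial>M) * (\<integral>x. (X n x)^4 \<partial>M))"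
      using 4 by simp
    also have "(\<integral>x. 64 * (b n)^4 * ((X n x)^8 + 1) \<partial>M) = 64 * (b n)^4 * ((\<integral>x. (X n x)^8 \<partial>M) + 1)"
    proof -
      have "integrable M (\<lambda>x. (X n x)^8)"
        by (intro int)
      then show ?thesis
        by (simp add: prob_space)
    qed
    also have "8 * ((\<integral>x. (?L n x)^4 \<partial>M) * (\<integral>x. (X n x)^4 \<partial>M)) + 64 * (b n)^4 * ((\<integral>x. (X n x)^8 \<partial>M) + 1)
        \<le> 8 * ((4 * \<kappa> * s)\<^sup>2 * \<kappa>) + 64 * (b n)^4 * (\<kappa> + \<kappa>)"
      unfolding s_def using \<kappa> linear_form_fourth_moment[of "a n" n] fourth eighth
      by (intro add_mono mult_left_mono mult_mono) auto
    also have "\<dots> = 128 * (\<kappa>^3 * s\<^sup>2) + 128 * (\<kappa> * ((b n)\<^sup>2)\<^sup>2)"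
      by (simp add: power_mult_distrib power2_eq_square power3_eq_cube power4_eq_xxxx)
    \<comment> \<open>128 is rounded up to \<open>12^2\<close>, and the powers of
      \<open>\<kappa>\<close> are raised to \<open>\<kappa>^4\<close>, to reach the square form that
      the inequality for sums expects.\<close>
    also have "\<dots> \<le> 144 * (\<kappa>^4 * s\<^sup>2) + 144 * (\<kappa>^4 * ((b n)\<^sup>2)\<^sup>2)"
      using \<kappa> power_increasing[of 3 4 \<kappa>] power_increasing[of 1 4 \<kappa>]
      by (intro add_mono mult_mono) auto
    also have "\<dots> \<le> (12 * \<kappa>\<^sup>2 * (s + (b n)\<^sup>2))\<^sup>2"
    proof -
      have "s\<^sup>2 + ((b n)\<^sup>2)\<^sup>2 \<le> (s + (b n)\<^sup>2)\<^sup>2"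
        using s by (simp add: power2_sum)
      then have "144 * \<kappa>^4 * (s\<^sup>2 + ((b n)\<^sup>2)\<^sup>2) \<le> 144 * \<kappa>^4 * (s + (b n)\<^sup>2)\<^sup>2"
        using \<kappa> by (intro mult_left_mono) auto
      moreover have "(12 * \<kappa>\<^sup>2 * (s + (b n)\<^sup>2))\<^sup>2 = 144 * \<kappa>^4 * (s + (b n)\<^sup>2)\<^sup>2"
        by (simp only: power_mult_distrib) simp
      ultimately show ?thesis
        by (simp only: distrib_left mult.assoc)
    qed
    finally show "(\<integral>x. (?L n x * X n x + b n * ((X n x)\<^sup>2 - 1))^4 \<partial>M)
        \<le> (12 * \<kappa>\<^sup>2 * ((\<Sum>k<n. (a n k)\<^sup>2) + (b n)\<^sup>2))\<^sup>2"
      unfolding s_def .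
  qed (use \<kappa> in \<open>auto intro!: add_nonneg_nonneg sum_nonneg\<close>)
  then show ?thesis
    by (simp add: quadratic_form_def)
qed

text \<open>Obtained from the fourth moment by Cauchy-Schwarz against 1 on a probability space. The
  constant is crude, but only convergence is drawn from it.\<close>

lemma quadratic_form_second_moment:
  "(\<integral>x. (quadratic_form a b n x)\<^sup>2 \<partial>M) \<le> 48 * \<kappa>\<^sup>2 * (\<Sum>j<n. (\<Sum>k<j. (a j k)\<^sup>2) + (b j)\<^sup>2)"
proof (rule power2_le_imp_le)
  have "(\<integral>x. (quadratic_form a b n x)\<^sup>2 * 1 \<partial>M)\<^sup>2
      \<le> (\<integral>x. ((quadratic_form a b n x)\<^sup>2)\<^sup>2 \<partial>M) * (\<integral>x. 1\<^sup>2 \<partial>M)"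
    by (intro L2_Cauchy_Schwarz all_moments_square_integrable all_moments_intros all_moments_quadratic_form)
  also have "\<dots> = (\<integral>x. (quadratic_form a b n x)^4 \<partial>M)"
    by (simp add: prob_space flip: power_mult)
  also note quadratic_form_fourth_moment
  finally show "(\<integral>x. (quadratic_form a b n x)\<^sup>2 \<partial>M)\<^sup>2
      \<le> (48 * \<kappa>\<^sup>2 * (\<Sum>j<n. (\<Sum>k<j. (a j k)\<^sup>2) + (b j)\<^sup>2))\<^sup>2"
    by simp
qed (intro mult_nonneg_nonneg sum_nonneg add_nonneg_nonneg; simp)

lemma quadratic_form_diff:
  "quadratic_form a b n x - quadratic_form a' b' n x
    = quadratic_form (\<lambda>j k. a j k - a' j k) (\<lambda>j. b j - b' j) n x"
  unfolding quadratic_form_def sum_subtractf[symmetric]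
  by (intro sum.cong refl) (simp add: sum_subtractf left_diff_distrib)

lemma quadratic_form_split:
  "quadratic_form a (\<lambda>_. 0) n x + quadratic_form (\<lambda>_ _. 0) b n x = quadratic_form a b n x"
  by (simp add: quadratic_form_def sum.distrib)

text \<open>Deleting the rows below \<open>m\<close> keeps the tail within the same class of forms,
  so the moment bounds apply to it unchanged.\<close>

lemma quadratic_form_tail:
  assumes "m \<le> n"
  shows "quadratic_form a b n x - quadratic_form a b m x
    = quadratic_form (\<lambda>j k. if m \<le> j then a j k else 0) (\<lambda>j. if m \<le> j then b j else 0) n x"
  using assms
proof (induction n rule: dec_induct)
  case base
  have "quadratic_form (\<lambda>j k. if m \<le> j then a j k else 0) (\<lambda>j. if m \<le> j then b j else 0) m x = 0"
    unfolding quadratic_form_def by (intro sum.neutral) auto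
  then show ?case
    by simp
next
  case (step n)
  then show ?case
    by (simp add: quadratic_form_def)
qed

text \<open>The squared distance of two partial forms is at most a constant times the gap between
  partial sums of a convergent series. \<open>Suc n\<close> matches series whose partial sums
  include the index \<open>n\<close>.\<close>

lemma quadratic_form_L2_limit:
  assumes bound: "\<And>n. (\<Sum>j<n. (\<Sum>k<j. (a j k)\<^sup>2) + (b j)\<^sup>2) \<le> B"
  shows "\<exists>Z. L2_limit M (\<lambda>n. quadratic_form a b (Suc n)) Z"
proof (rule L2_limit_if_Cauchy)
  show "square_integrable M (quadratic_form a b (Suc n))" for n
    by (intro all_moments_square_integrable all_moments_quadratic_form)
  define c where "c j = (\<Sum>k<j. (a j k)\<^sup>2) + (b j)\<^sup>2" for j
  define p where "p n = (\<Sum>j<n. c j)" for n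
  have c: "0 \<le> c j" for j
    unfolding c_def by (simp add: sum_nonneg)
  have tail: "(\<integral>x. (quadratic_form a b n x - quadratic_form a b m x)\<^sup>2 \<partial>M) \<le> 48 * \<kappa>\<^sup>2 * (p n - p m)"
    if "m \<le> n" for m n
  proof -
    have "(\<Sum>j<n. (\<Sum>k<j. (if m \<le> j then a j k else 0)\<^sup>2) + (if m \<le> j then b j else 0)\<^sup>2)
        = (\<Sum>j<n. if m \<le> j then c j else 0)"
      by (intro sum.cong refl) (auto simp: c_def)
    also have "\<dots> = p n - p m"
      using that by (induction n rule: dec_induct) (auto simp: p_def)
    finally show ?thesis
      unfolding quadratic_form_tail[OF that]
      using quadratic_form_second_moment[of "\<lambda>j k. if m \<le> j then a j k else 0" "\<lambda>j. if m \<le> j then b j else 0" n]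
      by simp
  qed
  have "(\<Sum>j\<le>n. c j) \<le> B" for n
    using bound[of "Suc n"] by (simp only: c_def lessThan_Suc_atMost)
  with c have "summable c"
    by (rule bounded_imp_summable)
  then have "Cauchy p"
    unfolding p_def by (simp add: summable_iff_convergent Cauchy_convergent_iff)
  fix \<epsilon> :: real assume \<epsilon>: "\<epsilon> > 0"
  have "48 * \<kappa>\<^sup>2 > 0"
    using \<kappa> by simp
  with \<epsilon> have "\<epsilon> / (48 * \<kappa>\<^sup>2) > 0"
    by simp
  with \<open>Cauchy p\<close> obtain N where N: "\<And>m n. m \<ge> N \<Longrightarrow> n \<ge> N \<Longrightarrow> norm (p m - p n) < \<epsilon> / (48 * \<kappa>\<^sup>2)"
    unfolding Cauchy_iff by meson
  have le: "(\<integral>x. (quadratic_form a b n x - quadratic_form a b m x)\<^sup>2 \<partial>M) \<le> \<epsilon>"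
    if "N \<le> m" "m \<le> n" for m n
  proof -
    have "p n - p m \<le> \<epsilon> / (48 * \<kappa>\<^sup>2)"
      using N[of n m] that by auto
    then have "48 * \<kappa>\<^sup>2 * (p n - p m) \<le> 48 * \<kappa>\<^sup>2 * (\<epsilon> / (48 * \<kappa>\<^sup>2))"
      by (intro mult_left_mono) auto
    also have "\<dots> = \<epsilon>"
      using \<kappa> by simp
    finally show ?thesis
      using tail[OF that(2)] by linarith
  qed
  show "\<exists>N. \<forall>m\<ge>N. \<forall>n\<ge>N. (\<integral>x. (quadratic_form a b (Suc m) x - quadratic_form a b (Suc n) x)\<^sup>2 \<partial>M) \<le> \<epsilon>"
  proof (intro exI allI impI)
    fix m n assume "N \<le> m" "N \<le> n"
    then show "(\<integral>x. (quadratic_form a b (Suc m) x - quadratic_form a b (Suc n) x)\<^sup>2 \<partial>M) \<le> \<epsilon>"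
    proof (cases "m \<le> n")
      case True
      show ?thesis
        unfolding power2_commute[of "quadratic_form a b (Suc m) _"]
        using \<open>N \<le> m\<close> True by (intro le) auto
    next
      case False
      then show ?thesis
        using \<open>N \<le> n\<close> by (intro le) auto
    qed
  qed
qed

end

text \<open>The identity map has the product law, and its marginals are the \<open>P n\<close>; that
  is independence of the coordinates.\<close>

lemma standardized_independent_coordinates:
  assumes sets_P: "\<And>n. sets (P n) = sets borel"
    and prob: "\<And>n. prob_space (P n)"
    and mean: "\<And>n. (\<integral>x. x \<partial>P n) = 0"
    and variance: "\<And>n. (\<integral>x. x\<^sup>2 \<partial>P n) = 1"
    and moments: "\<And>p::real. p > 0 \<Longrightarrow>
      \<exists>K::real. \<forall>n. integrable (P n) (\<lambda>x. \<bar>x\<bar> powr p) \<and> (\<integral>x. \<bar>x\<bar> powr p \<partial>P n) \<le> K"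
  shows "\<exists>\<kappa>. standardized_independent (path_measure P) (\<lambda>n \<omega>. \<omega> n) \<kappa>"
proof -
  \<comment> \<open>Positivity of \<open>p\<close> matters at \<open>x = 0\<close>:
    \<open>0 powr 0\<close> is 0 while \<open>0 ^ 0\<close> is 1.\<close>
  have powr_eq: "(\<lambda>x::real. \<bar>x\<bar> powr real p) = (\<lambda>x. \<bar>x\<bar> ^ p)" if "p > 0" for p :: nat
  proof
    show "\<bar>x\<bar> powr real p = \<bar>x\<bar> ^ p" for x :: real
      using that by (cases "x = 0") (auto simp: powr_realpow)
  qed
  have nat_moments: "\<exists>K. \<forall>n. integrable (P n) (\<lambda>x. \<bar>x\<bar> ^ p) \<and> (\<integral>x. \<bar>x\<bar> ^ p \<partial>P n) \<le> K"
    if "p > 0" for p :: nat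
    using moments[of "real p"] that unfolding powr_eq[OF that] by simp
  obtain K4 where K4: "\<And>n. (\<integral>x. \<bar>x\<bar> ^ 4 \<partial>P n) \<le> K4"
    using nat_moments[of 4] by auto
  obtain K8 where K8: "\<And>n. (\<integral>x. \<bar>x\<bar> ^ 8 \<partial>P n) \<le> K8"
    using nat_moments[of 8] by auto
  have meas [measurable]: "(\<lambda>\<omega>. \<omega> n) \<in> measurable (path_measure P) (P n)" for n
    unfolding path_measure_def by (rule measurable_component_singleton) simp
  have borel [measurable]: "(\<lambda>\<omega>. \<omega> n) \<in> borel_measurable (path_measure P)" for n
    using meas[of n] measurable_cong_sets[OF refl sets_P] by blast
  have distr: "distr (path_measure P) (P n) (\<lambda>\<omega>. \<omega> n) = P n" for n
    unfolding path_measure_def by (rule distr_PiM_component) (auto simp: prob)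
  have borel_P: "f \<in> borel_measurable (P n)" if "f \<in> borel_measurable borel" for f :: "real \<Rightarrow> real" and n
    using that measurable_cong_sets[OF sets_P refl] by blast
  have transfer_int: "(\<integral>\<omega>. f (\<omega> n) \<partial>path_measure P) = (\<integral>x. f x \<partial>P n)"
    if "f \<in> borel_measurable borel" for f :: "real \<Rightarrow> real" and n
    using integral_distr[OF meas borel_P[OF that]] by (simp add: distr)
  have transfer_integrable: "integrable (path_measure P) (\<lambda>\<omega>. f (\<omega> n)) = integrable (P n) f"
    if "f \<in> borel_measurable borel" for f :: "real \<Rightarrow> real" and n
    using integrable_distr_eq[OF meas borel_P[OF that]] by (simp add: distr)
  interpret prob_space "path_measure P"
    unfolding path_measure_def by (intro prob_space_PiM prob)
  have "standardized_independent (path_measure P) (\<lambda>n \<omega>. \<omega> n) (max 1 (max K4 K8))"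
  proof
    have distr_borel: "distr (path_measure P) borel (\<lambda>\<omega>. \<omega> n) = P n" for n
      using distr[of n] distr_cong[OF refl sets_P[of n], of "path_measure P" "\<lambda>\<omega>. \<omega> n" "\<lambda>\<omega>. \<omega> n"] by simp
    \<comment> \<open>\<open>P n\<close> has the Borel sets without being \<open>borel\<close>, so
      the two product sigma-algebras must be identified before the joint law can be compared with
      the product of the marginals.\<close>
    have "sets (PiM UNIV (\<lambda>_::nat. borel::real measure)) = sets (path_measure P)"
      unfolding path_measure_def by (intro sets_PiM_cong) (auto simp: sets_P)
    then have "distr (path_measure P) (PiM UNIV (\<lambda>_. borel)) (\<lambda>\<omega>. \<lambda>i\<in>UNIV. \<omega> i) = path_measure P"
      by (simp add: restrict_UNIV distr_id2)
    also have "\<dots> = PiM UNIV (\<lambda>i. distr (path_measure P) borel (\<lambda>\<omega>. \<omega> i))"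
      unfolding distr_borel by (rule path_measure_def)
    finally show "indep_vars (\<lambda>_. borel) (\<lambda>n \<omega>. \<omega> n) UNIV"
      by (subst indep_vars_iff_distr_eq_PiM') (auto simp: borel)
    show "all_moments (path_measure P) (\<lambda>\<omega>. \<omega> n)" for n
      unfolding all_moments_def
    proof (intro conjI allI borel)
      fix p :: nat
      show "integrable (path_measure P) (\<lambda>\<omega>. \<bar>\<omega> n\<bar> ^ p)"
      proof (cases "p = 0")
        case False
        then have "integrable (P n) (\<lambda>x. \<bar>x\<bar> ^ p)"
          using nat_moments[of p] by auto
        then show ?thesis
          by (subst transfer_integrable) auto
      qed simp
    qed
    show "(\<integral>\<omega>. \<omega> n \<partial>path_measure P) = 0" for n
      using transfer_int[of "\<lambda>x. x" n] mean by simp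
    show "(\<integral>\<omega>. (\<omega> n)\<^sup>2 \<partial>path_measure P) = 1" for n
      using transfer_int[of "\<lambda>x. x\<^sup>2" n] variance by simp
    show "(\<integral>\<omega>. (\<omega> n)^4 \<partial>path_measure P) \<le> max 1 (max K4 K8)" for n
      using transfer_int[of "\<lambda>x. x^4" n] K4[of n] by simp
    show "(\<integral>\<omega>. (\<omega> n)^8 \<partial>path_measure P) \<le> max 1 (max K4 K8)" for n
      using transfer_int[of "\<lambda>x. x^8" n] K8[of n] by simp
  qed simp
  then show ?thesis
    by blast
qed

section \<open>The kernels of the double integral\<close>

lemma square_integrable_mult_left: "square_integrable M f \<Longrightarrow> square_integrable M (\<lambda>x. c * f x)"
  by (auto simp: square_integrable_def power_mult_distrib)

lemma square_integrable_sum: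
  assumes "\<And>i. i \<in> I \<Longrightarrow> square_integrable M (f i)"
  shows "square_integrable M (\<lambda>x. \<Sum>i\<in>I. f i x)"
  using assms
proof (induction I rule: infinite_finite_induct)
  case (insert i I)
  then show ?case
    by (auto intro!: square_integrable_add)
qed (auto simp: square_integrable_def)

lemma square_integrable_mono:
  assumes "square_integrable M g" "f \<in> borel_measurable M" "\<And>x. \<bar>f x\<bar> \<le> \<bar>g x\<bar>"
  shows "square_integrable M f"
  unfolding square_integrable_def
proof
  note [measurable] = assms(2)
  have le: "(f x)\<^sup>2 \<le> (g x)\<^sup>2" for x
    using assms(3) abs_le_square_iff by blast
  show "integrable M (\<lambda>x. (f x)\<^sup>2)"
  proof (rule Bochner_Integration.integrable_bound)
    show "integrable M (\<lambda>x. (g x)\<^sup>2)"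
      using assms(1) by (simp add: square_integrable_def)
    show "AE x in M. norm ((f x)\<^sup>2) \<le> norm ((g x)\<^sup>2)"
      by (rule AE_I2) (simp only: real_norm_def abs_power2 le)
  qed measurable
qed fact

lemma L2_inner_diff:
  assumes "square_integrable M f" "square_integrable M g" "square_integrable M u"
  shows "L2_inner M (\<lambda>x. f x - g x) u = L2_inner M f u - L2_inner M g u"
  using assms unfolding L2_inner_def by (simp add: left_diff_distrib integrable_mult_square_integrable)

text \<open>The squared distance from \<open>f\<close> to its projection \<open>g\<close> is
  nonnegative. The index type is arbitrary so that pairs are allowed.\<close>

lemma Bessel_inequality:
  assumes I: "finite I" and u: "\<And>i. i \<in> I \<Longrightarrow> square_integrable M (u i)"
    and orth: "\<And>i j. i \<in> I \<Longrightarrow> j \<in> I \<Longrightarrow> L2_inner M (u i) (u j) = (if i = j then 1 else 0)"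
    and f: "square_integrable M f"
  shows "(\<Sum>i\<in>I. (L2_inner M f (u i))\<^sup>2) \<le> (\<integral>x. (f x)\<^sup>2 \<partial>M)"
proof -
  define c where "c i = L2_inner M f (u i)" for i
  define g where "g x = (\<Sum>i\<in>I. c i * u i x)" for x
  have g: "square_integrable M g"
    unfolding g_def by (intro square_integrable_sum square_integrable_mult_left u)
  have int: "integrable M (\<lambda>x. h x * u i x)" if "square_integrable M h" "i \<in> I" for h i
    by (intro integrable_mult_square_integrable u that)
  have with_g: "(\<integral>x. h x * g x \<partial>M) = (\<Sum>i\<in>I. c i * L2_inner M h (u i))"
    if "square_integrable M h" for h
  proof -
    have "(\<integral>x. h x * g x \<partial>M) = (\<integral>x. (\<Sum>i\<in>I. c i * (h x * u i x)) \<partial>M)"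
      unfolding g_def sum_distrib_left by (simp only: mult.left_commute)
    also have "\<dots> = (\<Sum>i\<in>I. c i * L2_inner M h (u i))"
      unfolding L2_inner_def
      by (subst Bochner_Integration.integral_sum) (auto intro!: int that)
    finally show ?thesis .
  qed
  have "L2_inner M g (u i) = c i" if "i \<in> I" for i
  proof -
    have "L2_inner M g (u i) = (\<integral>x. u i x * g x \<partial>M)"
      by (simp add: L2_inner_def mult.commute)
    also have "\<dots> = (\<Sum>j\<in>I. c j * (if i = j then 1 else 0))"
      using with_g[OF u[OF that]] orth that by (simp cong: sum.cong)
    also have "\<dots> = (\<Sum>j\<in>I. if i = j then c j else 0)"
      by (intro sum.cong) auto
    also have "\<dots> = c i"
      using I that by simp
    finally show ?thesis .
  qed
  then have gg: "(\<integral>x. g x * g x \<partial>M) = (\<Sum>i\<in>I. (c i)\<^sup>2)"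
    by (subst with_g[OF g]) (auto simp: power2_eq_square intro!: sum.cong)
  have fg: "(\<integral>x. f x * g x \<partial>M) = (\<Sum>i\<in>I. (c i)\<^sup>2)"
    by (subst with_g[OF f]) (simp add: c_def power2_eq_square)
  have "0 \<le> (\<integral>x. (f x - g x)\<^sup>2 \<partial>M)"
    by simp
  also have "\<dots> = (\<integral>x. (f x)\<^sup>2 - 2 * (f x * g x) + g x * g x \<partial>M)"
    by (intro Bochner_Integration.integral_cong) (auto simp: power2_eq_square algebra_simps)
  also have "\<dots> = (\<integral>x. (f x)\<^sup>2 \<partial>M) - 2 * (\<integral>x. f x * g x \<partial>M) + (\<integral>x. g x * g x \<partial>M)"
  proof -
    have "integrable M (\<lambda>x. (f x)\<^sup>2)"
      using f by (simp add: square_integrable_def)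
    then show ?thesis
      using integrable_mult_square_integrable[OF f g] integrable_mult_square_integrable[OF g g] by simp
  qed
  finally show ?thesis
    unfolding gg fg by (simp add: c_def)
qed

lemma (in pair_sigma_finite) integral_product_functions:
  fixes f :: "'a \<Rightarrow> real" and g :: "'b \<Rightarrow> real"
  assumes f: "integrable M1 f" and g: "integrable M2 g"
  shows "integrable (M1 \<Otimes>\<^sub>M M2) (\<lambda>(x, y). f x * g y)"
    and "(\<integral>(x, y). f x * g y \<partial>(M1 \<Otimes>\<^sub>M M2)) = (\<integral>x. f x \<partial>M1) * (\<integral>y. g y \<partial>M2)"
proof -
  have [measurable]: "f \<in> borel_measurable M1" "g \<in> borel_measurable M2"
    using f g by auto
  show int: "integrable (M1 \<Otimes>\<^sub>M M2) (\<lambda>(x, y). f x * g y)"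
    by (rule Fubini_integrable) (use f g in \<open>auto simp: abs_mult\<close>)
  show "(\<integral>(x, y). f x * g y \<partial>(M1 \<Otimes>\<^sub>M M2)) = (\<integral>x. f x \<partial>M1) * (\<integral>y. g y \<partial>M2)"
    using integral_fst'[OF int] by simp
qed

lemma square_integrable_tensor:
  assumes "sigma_finite_measure \<mu>" and f: "square_integrable \<mu> f" and g: "square_integrable \<mu> g"
  shows "square_integrable (\<mu> \<Otimes>\<^sub>M \<mu>) (f \<otimes>\<^sub>t g)"
    and "(\<integral>z. ((f \<otimes>\<^sub>t g) z)\<^sup>2 \<partial>(\<mu> \<Otimes>\<^sub>M \<mu>)) = (\<integral>x. (f x)\<^sup>2 \<partial>\<mu>) * (\<integral>x. (g x)\<^sup>2 \<partial>\<mu>)"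
proof -
  interpret sigma_finite_measure \<mu> by fact
  interpret pair_sigma_finite \<mu> \<mu> ..
  have [measurable]: "f \<in> borel_measurable \<mu>" "g \<in> borel_measurable \<mu>"
    and int: "integrable \<mu> (\<lambda>x. (f x)\<^sup>2)" "integrable \<mu> (\<lambda>x. (g x)\<^sup>2)"
    using f g by (auto simp: square_integrable_def)
  have eq: "(\<lambda>z. ((f \<otimes>\<^sub>t g) z)\<^sup>2) = (\<lambda>(x, y). (f x)\<^sup>2 * (g y)\<^sup>2)"
    by (auto simp: tensor_def power_mult_distrib)
  show "square_integrable (\<mu> \<Otimes>\<^sub>M \<mu>) (f \<otimes>\<^sub>t g)"
    unfolding square_integrable_def eq using integral_product_functions(1)[OF int]
    by (simp add: tensor_def)
  show "(\<integral>z. ((f \<otimes>\<^sub>t g) z)\<^sup>2 \<partial>(\<mu> \<Otimes>\<^sub>M \<mu>)) = (\<integral>x. (f x)\<^sup>2 \<partial>\<mu>) * (\<integral>x. (g x)\<^sup>2 \<partial>\<mu>)"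
    unfolding eq by (rule integral_product_functions(2)[OF int])
qed

lemma L2_inner_tensor:
  assumes "sigma_finite_measure \<mu>" "square_integrable \<mu> f" "square_integrable \<mu> g"
    "square_integrable \<mu> f'" "square_integrable \<mu> g'"
  shows "L2_inner (\<mu> \<Otimes>\<^sub>M \<mu>) (f \<otimes>\<^sub>t g) (f' \<otimes>\<^sub>t g') = L2_inner \<mu> f f' * L2_inner \<mu> g g'"
proof -
  interpret sigma_finite_measure \<mu> by fact
  interpret pair_sigma_finite \<mu> \<mu> ..
  have eq: "(\<lambda>z. (f \<otimes>\<^sub>t g) z * (f' \<otimes>\<^sub>t g') z) = (\<lambda>(x, y). (f x * f' x) * (g y * g' y))"
    by (auto simp: tensor_def)
  show ?thesis
    unfolding L2_inner_def eq
    using assms by (intro integral_product_functions(2) integrable_mult_square_integrable)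
qed

text \<open>Tensor products of an orthonormal system are orthonormal for the product measure. With
  any finite set of pairs allowed, the strict triangle and the diagonal are both instances.\<close>

lemma Bessel_tensor:
  fixes e :: "'i \<Rightarrow> real \<Rightarrow> real"
  assumes \<mu>: "sigma_finite_measure \<mu>" and e: "\<And>n. square_integrable \<mu> (e n)"
    and orth: "\<And>m n. L2_inner \<mu> (e m) (e n) = (if m = n then 1 else 0)"
    and f: "square_integrable (\<mu> \<Otimes>\<^sub>M \<mu>) f" and I: "finite I"
  shows "(\<Sum>(j, k)\<in>I. (L2_inner (\<mu> \<Otimes>\<^sub>M \<mu>) f (e j \<otimes>\<^sub>t e k))\<^sup>2) \<le> (\<integral>z. (f z)\<^sup>2 \<partial>(\<mu> \<Otimes>\<^sub>M \<mu>))"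
proof -
  have "(\<Sum>i\<in>I. (L2_inner (\<mu> \<Otimes>\<^sub>M \<mu>) f (case i of (j, k) \<Rightarrow> e j \<otimes>\<^sub>t e k))\<^sup>2) \<le> (\<integral>z. (f z)\<^sup>2 \<partial>(\<mu> \<Otimes>\<^sub>M \<mu>))"
  proof (rule Bessel_inequality[OF I _ _ f])
    fix i i' :: "'i \<times> 'i"
    obtain j k j' k' where i: "i = (j, k)" "i' = (j', k')"
      by (meson surj_pair)
    show "square_integrable (\<mu> \<Otimes>\<^sub>M \<mu>) (case i of (j, k) \<Rightarrow> e j \<otimes>\<^sub>t e k)"
      unfolding i by (simp add: square_integrable_tensor \<mu> e)
    show "L2_inner (\<mu> \<Otimes>\<^sub>M \<mu>) (case i of (j, k) \<Rightarrow> e j \<otimes>\<^sub>t e k) (case i' of (j, k) \<Rightarrow> e j \<otimes>\<^sub>t e k)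
        = (if i = i' then 1 else 0)"
      unfolding i by (simp add: L2_inner_tensor \<mu> e orth)
  qed
  then show ?thesis
    by (simp add: case_prod_beta)
qed

context
  fixes \<mu> :: "real measure" and e :: "nat \<Rightarrow> real \<Rightarrow> real" and f :: "real \<times> real \<Rightarrow> real"
  assumes \<mu>: "sigma_finite_measure \<mu>" and e: "\<And>n. square_integrable \<mu> (e n)"
    and orth: "\<And>m n. L2_inner \<mu> (e m) (e n) = (if m = n then 1 else 0)"
    and f: "square_integrable (\<mu> \<Otimes>\<^sub>M \<mu>) f"
begin

lemma Bessel_tensor_off_diagonal:
  "(\<Sum>j<n. \<Sum>k<j. (L2_inner (\<mu> \<Otimes>\<^sub>M \<mu>) f (e j \<otimes>\<^sub>t e k))\<^sup>2) \<le> (\<integral>z. (f z)\<^sup>2 \<partial>(\<mu> \<Otimes>\<^sub>M \<mu>))"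
  using Bessel_tensor[OF \<mu> e orth f, of "Sigma {..<n} (\<lambda>j. {..<j})"]
  by (simp add: sum.Sigma finite_SigmaI)

lemma Bessel_tensor_diagonal:
  "(\<Sum>j<n. (L2_inner (\<mu> \<Otimes>\<^sub>M \<mu>) f (e j \<otimes>\<^sub>t e j))\<^sup>2) \<le> (\<integral>z. (f z)\<^sup>2 \<partial>(\<mu> \<Otimes>\<^sub>M \<mu>))"
  using Bessel_tensor[OF \<mu> e orth f, of "(\<lambda>j. (j, j)) ` {..<n}"]
  by (simp add: sum.reindex inj_on_def)

end

section \<open>Kernels on the triangles and their increments\<close>

definition upper_kernel :: "(real \<Rightarrow> real) \<Rightarrow> (real \<Rightarrow> real) \<Rightarrow> real \<Rightarrow> real \<times> real \<Rightarrow> real" where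
  "upper_kernel h g t z = (h \<otimes>\<^sub>t g) z * indicator (upper_triangle t) z"

text \<open>The second term is the first with its arguments exchanged: the symmetrization of the
  upper kernel without the factor 1/2.\<close>

definition symmetric_kernel :: "(real \<Rightarrow> real) \<Rightarrow> (real \<Rightarrow> real) \<Rightarrow> real \<Rightarrow> real \<times> real \<Rightarrow> real" where
  "symmetric_kernel h g t z = (h \<otimes>\<^sub>t g) z * indicator (upper_triangle t) z
    + (g \<otimes>\<^sub>t h) z * indicator (lower_triangle t) z"

text \<open>The clock of the process. The density makes a finite measure out of a merely
  sigma-finite one, so that distribution functions apply.\<close>

definition squared_cdf :: "real measure \<Rightarrow> (real \<Rightarrow> real) \<Rightarrow> real \<Rightarrow> real" where
  "squared_cdf \<mu> g = cdf (density \<mu> (\<lambda>x. ennreal ((g x)\<^sup>2)))"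

locale square_integrable_pair =
  fixes \<mu> :: "real measure" and h g :: "real \<Rightarrow> real"
  assumes sets_eq [measurable_cong]: "sets \<mu> = sets borel"
    and sigma_finite: "sigma_finite_measure \<mu>"
    and h: "square_integrable \<mu> h" and g: "square_integrable \<mu> g"
begin

lemma measurable_hg [measurable]: "h \<in> borel_measurable borel" "g \<in> borel_measurable borel"
  using h g by (simp_all add: square_integrable_def measurable_cong_sets[OF sets_eq refl])

lemma space_eq: "space \<mu> = UNIV"
  using sets_eq_imp_space_eq[OF sets_eq] by simp

lemma finite_borel_measure_squared_density:
  "finite_borel_measure (density \<mu> (\<lambda>x. ennreal ((g x)\<^sup>2)))"
proof -
  have "(\<integral>\<^sup>+x. ennreal ((g x)\<^sup>2) \<partial>\<mu>) < \<infinity>"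
    using g by (auto simp: square_integrable_def integrable_iff_bounded)
  then have "finite_measure (density \<mu> (\<lambda>x. ennreal ((g x)\<^sup>2)))"
    by (intro finite_measureI, subst emeasure_density) (auto simp: space_eq sets_eq)
  then show ?thesis
    by (simp add: finite_borel_measure_def finite_borel_measure_axioms_def sets_eq)
qed

lemma squared_cdf_mono: "s \<le> t \<Longrightarrow> squared_cdf \<mu> g s \<le> squared_cdf \<mu> g t"
  unfolding squared_cdf_def
  by (rule finite_borel_measure.cdf_nondecreasing[OF finite_borel_measure_squared_density])

text \<open>A measure with a density charges no point that the base measure does not charge, and a
  distribution function jumps only at charged points.\<close>

lemma continuous_on_squared_cdf:
  assumes "\<And>x. emeasure \<mu> {x} = 0"
  shows "continuous_on S (squared_cdf \<mu> g)"
proof (rule continuous_at_imp_continuous_on, rule ballI)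
  interpret finite_borel_measure "density \<mu> (\<lambda>x. ennreal ((g x)\<^sup>2))"
    by (rule finite_borel_measure_squared_density)
  fix x
  have "{x} \<in> null_sets \<mu>"
    using assms by (auto simp: null_sets_def sets_eq)
  then have "{x} \<in> null_sets (density \<mu> (\<lambda>x. ennreal ((g x)\<^sup>2)))"
    using absolutely_continuousI_density[of "\<lambda>x. ennreal ((g x)\<^sup>2)" \<mu>]
    by (auto simp: absolutely_continuous_def)
  then show "isCont (squared_cdf \<mu> g) x"
    unfolding squared_cdf_def isCont_cdf by (simp add: measure_def null_sets_def)
qed

lemma squared_cdf_diff:
  assumes "s \<le> t"
  shows "squared_cdf \<mu> g t - squared_cdf \<mu> g s = (\<integral>x. (g x * indicator {s<..t} x)\<^sup>2 \<partial>\<mu>)"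
proof (cases "s = t")
  case False
  interpret finite_borel_measure "density \<mu> (\<lambda>x. ennreal ((g x)\<^sup>2))"
    by (rule finite_borel_measure_squared_density)
  have "squared_cdf \<mu> g t - squared_cdf \<mu> g s = measure (density \<mu> (\<lambda>x. ennreal ((g x)\<^sup>2))) {s<..t}"
    unfolding squared_cdf_def using False assms by (intro cdf_diff_eq) simp
  also have "\<dots> = enn2real (\<integral>\<^sup>+x. ennreal ((g x)\<^sup>2) * indicator {s<..t} x \<partial>\<mu>)"
    unfolding measure_def by (subst emeasure_density) (auto simp: sets_eq)
  also have "(\<integral>\<^sup>+x. ennreal ((g x)\<^sup>2) * indicator {s<..t} x \<partial>\<mu>) = (\<integral>\<^sup>+x. ennreal ((g x * indicator {s<..t} x)\<^sup>2) \<partial>\<mu>)"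
    by (intro nn_integral_cong) (auto split: split_indicator)
  also have "enn2real \<dots> = (\<integral>x. (g x * indicator {s<..t} x)\<^sup>2 \<partial>\<mu>)"
    by (rule integral_eq_nn_integral[symmetric]) auto
  finally show ?thesis .
qed simp

lemma measurable_kernels [measurable]:
  "upper_kernel h g t \<in> borel_measurable (\<mu> \<Otimes>\<^sub>M \<mu>)"
  "symmetric_kernel h g t \<in> borel_measurable (\<mu> \<Otimes>\<^sub>M \<mu>)"
proof -
  have [measurable]: "upper_triangle t \<in> sets (\<mu> \<Otimes>\<^sub>M \<mu>)"
  proof -
    have "upper_triangle t = {z \<in> space (\<mu> \<Otimes>\<^sub>M \<mu>). 0 \<le> fst z \<and> fst z < snd z \<and> snd z \<le> t}"
      by (auto simp: upper_triangle_def space_pair_measure space_eq)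
    also have "\<dots> \<in> sets (\<mu> \<Otimes>\<^sub>M \<mu>)"
      by measurable
    finally show ?thesis .
  qed
  have [measurable]: "lower_triangle t \<in> sets (\<mu> \<Otimes>\<^sub>M \<mu>)"
  proof -
    have "lower_triangle t = {z \<in> space (\<mu> \<Otimes>\<^sub>M \<mu>). 0 \<le> snd z \<and> snd z < fst z \<and> fst z \<le> t}"
      by (auto simp: lower_triangle_def space_pair_measure space_eq)
    also have "\<dots> \<in> sets (\<mu> \<Otimes>\<^sub>M \<mu>)"
      by measurable
    finally show ?thesis .
  qed
  have [measurable]: "(h \<otimes>\<^sub>t g) \<in> borel_measurable (\<mu> \<Otimes>\<^sub>M \<mu>)" "(g \<otimes>\<^sub>t h) \<in> borel_measurable (\<mu> \<Otimes>\<^sub>M \<mu>)"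
    unfolding tensor_def by measurable
  show "upper_kernel h g t \<in> borel_measurable (\<mu> \<Otimes>\<^sub>M \<mu>)"
    unfolding upper_kernel_def by measurable
  show "symmetric_kernel h g t \<in> borel_measurable (\<mu> \<Otimes>\<^sub>M \<mu>)"
    unfolding symmetric_kernel_def by measurable
qed

lemma square_integrable_kernels:
  "square_integrable (\<mu> \<Otimes>\<^sub>M \<mu>) (upper_kernel h g t)"
  "square_integrable (\<mu> \<Otimes>\<^sub>M \<mu>) (symmetric_kernel h g t)"
proof -
  have hg: "square_integrable (\<mu> \<Otimes>\<^sub>M \<mu>) (h \<otimes>\<^sub>t g)" "square_integrable (\<mu> \<Otimes>\<^sub>M \<mu>) (g \<otimes>\<^sub>t h)"
    by (intro square_integrable_tensor sigma_finite h g)+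
  show "square_integrable (\<mu> \<Otimes>\<^sub>M \<mu>) (upper_kernel h g t)"
    by (rule square_integrable_mono[OF hg(1)]) (auto simp: upper_kernel_def split: split_indicator)
  \<comment> \<open>The majorant is the sum of the absolute values, since the two tensors themselves
    could cancel.\<close>
  have abs: "square_integrable (\<mu> \<Otimes>\<^sub>M \<mu>) (\<lambda>z. \<bar>f z\<bar>)" if "square_integrable (\<mu> \<Otimes>\<^sub>M \<mu>) f" for f
    using that by (auto simp: square_integrable_def)
  show "square_integrable (\<mu> \<Otimes>\<^sub>M \<mu>) (symmetric_kernel h g t)"
    by (rule square_integrable_mono[OF square_integrable_add[OF hg[THEN abs]]])
      (auto simp: symmetric_kernel_def split: split_indicator)
qed

text \<open>Going from \<open>s\<close> to \<open>t\<close> adds only points whose larger coordinate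
  lies in ]s, t], and in both triangles that coordinate is the argument of \<open>g\<close>. Hence
  the tensors of \<open>h\<close> with \<open>g\<close> cut off to ]s, t] dominate the increment,
  and the clock involves \<open>g\<close> alone. The triangles are disjoint, so the symmetric kernel
  produces no cross term and the factor is 2.\<close>

lemma kernel_increments:
  assumes "s \<le> t"
  defines "\<delta> \<equiv> (\<integral>x. (h x)\<^sup>2 \<partial>\<mu>) * (squared_cdf \<mu> g t - squared_cdf \<mu> g s)"
  shows "(\<integral>z. (upper_kernel h g t z - upper_kernel h g s z)\<^sup>2 \<partial>(\<mu> \<Otimes>\<^sub>M \<mu>)) \<le> \<delta>"
    and "(\<integral>z. (symmetric_kernel h g t z - symmetric_kernel h g s z)\<^sup>2 \<partial>(\<mu> \<Otimes>\<^sub>M \<mu>)) \<le> 2 * \<delta>"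
proof -
  define gs where "gs x = g x * indicator {s<..t} x" for x
  have gs: "square_integrable \<mu> gs"
    by (rule square_integrable_mono[OF g]) (auto simp: gs_def[abs_def] split: split_indicator)
  note tensors = square_integrable_tensor[OF sigma_finite h gs] square_integrable_tensor[OF sigma_finite gs h]
  have \<delta>: "(\<integral>z. ((h \<otimes>\<^sub>t gs) z)\<^sup>2 \<partial>(\<mu> \<Otimes>\<^sub>M \<mu>)) = \<delta>" "(\<integral>z. ((gs \<otimes>\<^sub>t h) z)\<^sup>2 \<partial>(\<mu> \<Otimes>\<^sub>M \<mu>)) = \<delta>"
    using tensors squared_cdf_diff[OF assms(1)] by (simp_all add: \<delta>_def gs_def mult.commute)
  have int: "integrable (\<mu> \<Otimes>\<^sub>M \<mu>) (\<lambda>z. ((h \<otimes>\<^sub>t gs) z)\<^sup>2)" "integrable (\<mu> \<Otimes>\<^sub>M \<mu>) (\<lambda>z. ((gs \<otimes>\<^sub>t h) z)\<^sup>2)"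
    using tensors by (auto simp: square_integrable_def)
  have "(\<integral>z. (upper_kernel h g t z - upper_kernel h g s z)\<^sup>2 \<partial>(\<mu> \<Otimes>\<^sub>M \<mu>)) \<le> (\<integral>z. ((h \<otimes>\<^sub>t gs) z)\<^sup>2 \<partial>(\<mu> \<Otimes>\<^sub>M \<mu>))"
  proof (intro integral_mono square_integrable_diff square_integrable_kernels int)
    fix z :: "real \<times> real"
    show "(upper_kernel h g t z - upper_kernel h g s z)\<^sup>2 \<le> ((h \<otimes>\<^sub>t gs) z)\<^sup>2"
      using assms(1) by (cases z)
        (auto simp: upper_kernel_def tensor_def gs_def upper_triangle_def indicator_def)
  qed
  then show "(\<integral>z. (upper_kernel h g t z - upper_kernel h g s z)\<^sup>2 \<partial>(\<mu> \<Otimes>\<^sub>M \<mu>)) \<le> \<delta>"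
    unfolding \<delta> .
  have "(\<integral>z. (symmetric_kernel h g t z - symmetric_kernel h g s z)\<^sup>2 \<partial>(\<mu> \<Otimes>\<^sub>M \<mu>))
      \<le> (\<integral>z. ((h \<otimes>\<^sub>t gs) z)\<^sup>2 + ((gs \<otimes>\<^sub>t h) z)\<^sup>2 \<partial>(\<mu> \<Otimes>\<^sub>M \<mu>))"
  proof (intro integral_mono square_integrable_diff square_integrable_kernels Bochner_Integration.integrable_add int)
    fix z :: "real \<times> real"
    show "(symmetric_kernel h g t z - symmetric_kernel h g s z)\<^sup>2 \<le> ((h \<otimes>\<^sub>t gs) z)\<^sup>2 + ((gs \<otimes>\<^sub>t h) z)\<^sup>2"
      using assms(1) by (cases z)
        (auto simp: symmetric_kernel_def tensor_def gs_def upper_triangle_def lower_triangle_def indicator_def mult.commute)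
  qed
  also have "\<dots> = 2 * \<delta>"
    using int \<delta> by simp
  finally show "(\<integral>z. (symmetric_kernel h g t z - symmetric_kernel h g s z)\<^sup>2 \<partial>(\<mu> \<Otimes>\<^sub>M \<mu>)) \<le> 2 * \<delta>" .
qed

end

section \<open>The double integral\<close>

theorem mainTheorem2:
  fixes \<mu> :: "real measure"
    and e :: "nat \<Rightarrow> real \<Rightarrow> real"
    and P :: "nat \<Rightarrow> real measure"
    and h\<^sub>1 h\<^sub>2 :: "real \<Rightarrow> real"
  assumes "sets \<mu> = sets borel"
    and "sigma_finite_measure \<mu>"
    and diffuse: "\<And>x. emeasure \<mu> {x} = 0"
    and "hilbert_basis \<mu> e"
    and "\<And>n. sets (P n) = sets borel"
    and "\<And>n. prob_space (P n)"
    and mean: "\<And>n. (\<integral>x. x \<partial>P n) = 0"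
    and variance: "\<And>n. (\<integral>x. x\<^sup>2 \<partial>P n) = 1"
    and moments: "\<And>p::real. p > 0 \<Longrightarrow>
          \<exists>K::real. \<forall>n. integrable (P n) (\<lambda>x. \<bar>x\<bar> powr p) \<and> (\<integral>x. \<bar>x\<bar> powr p \<partial>P n) \<le> K"
    and "square_integrable \<mu> h\<^sub>1"
    and "square_integrable \<mu> h\<^sub>2"
  shows "\<exists>Z :: real \<Rightarrow> (nat \<Rightarrow> real) \<Rightarrow> real.
           (\<forall>t\<ge>0. Z t \<in> borel_measurable (path_measure P)) \<and>
           (\<forall>\<omega>\<in>space (path_measure P). continuous_on {0..} (\<lambda>t. Z t \<omega>)) \<and>
           (\<forall>t\<ge>0. AE \<omega> in path_measure P. Z t \<omega> = double_integral \<mu> e P h\<^sub>1 h\<^sub>2 t \<omega>)"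
proof -
  obtain \<kappa> where "standardized_independent (path_measure P) (\<lambda>n \<omega>. \<omega> n) \<kappa>"
    using standardized_independent_coordinates[of P] assms(5-9) by blast
  then interpret standardized_independent "path_measure P" "\<lambda>n \<omega>. \<omega> n" \<kappa> .
  interpret square_integrable_pair \<mu> h\<^sub>1 h\<^sub>2
    using assms(1,2,10,11) by (rule square_integrable_pair.intro)
  have e: "\<And>n. square_integrable \<mu> (e n)"
    and orth: "\<And>m n. L2_inner \<mu> (e m) (e n) = (if m = n then 1 else 0)"
    using \<open>hilbert_basis \<mu> e\<close> by (auto simp: hilbert_basis_def)
  have tensor: "square_integrable (\<mu> \<Otimes>\<^sub>M \<mu>) (e j \<otimes>\<^sub>t e k)" for j k
    by (intro square_integrable_tensor sigma_finite e)
  define F G where "F = symmetric_kernel h\<^sub>1 h\<^sub>2" and "G = upper_kernel h\<^sub>1 h\<^sub>2"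
  have F: "square_integrable (\<mu> \<Otimes>\<^sub>M \<mu>) (F t)" and G: "square_integrable (\<mu> \<Otimes>\<^sub>M \<mu>) (G t)" for t
    unfolding F_def G_def by (rule square_integrable_kernels)+
  define a where "a f j k = L2_inner (\<mu> \<Otimes>\<^sub>M \<mu>) f (e j \<otimes>\<^sub>t e k)" for f j k
  have off_diagonal: "(\<Sum>j<n. \<Sum>k<j. (a f j k)\<^sup>2) \<le> (\<integral>z. (f z)\<^sup>2 \<partial>(\<mu> \<Otimes>\<^sub>M \<mu>))"
    and diagonal: "(\<Sum>j<n. (a f j j)\<^sup>2) \<le> (\<integral>z. (f z)\<^sup>2 \<partial>(\<mu> \<Otimes>\<^sub>M \<mu>))"
    if "square_integrable (\<mu> \<Otimes>\<^sub>M \<mu>) f" for f n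
    unfolding a_def
    by (intro Bessel_tensor_off_diagonal Bessel_tensor_diagonal sigma_finite e orth that)+
  define Z where "Z = double_integral \<mu> e P h\<^sub>1 h\<^sub>2"
  \<comment> \<open>Both parts are merged into one form, with off-diagonal coefficients from
    \<open>F t\<close> and diagonal ones from \<open>G t\<close>, so that a single moment estimate
    covers them. The chosen representatives are usable only after existence of the limits, which
    Bessel supplies.\<close>
  have Z_lim: "L2_limit (path_measure P) (\<lambda>n. quadratic_form (a (F t)) (\<lambda>j. a (G t) j j) (Suc n)) (Z t)" for t
  proof -
    have phi11: "phi11 \<mu> e P (F t)
        = L2_lim (path_measure P) (\<lambda>n. quadratic_form (a (F t)) (\<lambda>_. 0) (Suc n))"
    proof -
      \<comment> \<open>The extra row \<open>j = 0\<close> of the form has an empty inner sum and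
        contributes nothing.\<close>
      have "(\<Sum>j=1..n. (\<Sum>k<j. a (F t) j k * \<omega> k) * \<omega> j) = quadratic_form (a (F t)) (\<lambda>_. 0) (Suc n) \<omega>" for n \<omega>
        unfolding quadratic_form_def by (rule sum.mono_neutral_cong_left) (auto simp: Suc_le_eq)
      then show ?thesis
        unfolding phi11_def by (simp only: a_def[symmetric])
    qed
    have phi2: "phi2 \<mu> e P (G t)
        = L2_lim (path_measure P) (\<lambda>n. quadratic_form (\<lambda>_ _. 0) (\<lambda>j. a (G t) j j) (Suc n))"
      unfolding phi2_def quadratic_form_def a_def by (simp add: atLeast0AtMost lessThan_Suc_atMost)
    have "L2_limit (path_measure P) (\<lambda>n. quadratic_form (a (F t)) (\<lambda>_. 0) (Suc n)) (phi11 \<mu> e P (F t))"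
      unfolding phi11
    proof (intro L2_lim_eqI quadratic_form_L2_limit)
      show "(\<Sum>j<n. (\<Sum>k<j. (a (F t) j k)\<^sup>2) + 0\<^sup>2) \<le> (\<integral>z. (F t z)\<^sup>2 \<partial>(\<mu> \<Otimes>\<^sub>M \<mu>))" for n
        using off_diagonal[OF F] by simp
    qed
    moreover have "L2_limit (path_measure P) (\<lambda>n. quadratic_form (\<lambda>_ _. 0) (\<lambda>j. a (G t) j j) (Suc n))
        (phi2 \<mu> e P (G t))"
      unfolding phi2
    proof (intro L2_lim_eqI quadratic_form_L2_limit)
      show "(\<Sum>j<n. (\<Sum>k<j. 0\<^sup>2) + (a (G t) j j)\<^sup>2) \<le> (\<integral>z. (G t z)\<^sup>2 \<partial>(\<mu> \<Otimes>\<^sub>M \<mu>))" for n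
        using diagonal[OF G] by simp
    qed
    ultimately have "L2_limit (path_measure P) (\<lambda>n. quadratic_form (a (F t)) (\<lambda>j. a (G t) j j) (Suc n))
        (\<lambda>\<omega>. phi11 \<mu> e P (F t) \<omega> + phi2 \<mu> e P (G t) \<omega>)"
      using L2_limit_add by (fastforce simp: quadratic_form_split)
    moreover have "Z t = (\<lambda>\<omega>. phi11 \<mu> e P (F t) \<omega> + phi2 \<mu> e P (G t) \<omega>)"
      unfolding Z_def double_integral_def F_def G_def symmetric_kernel_def[abs_def] upper_kernel_def[abs_def] ..
    ultimately show ?thesis
      by simp
  qed
  \<comment> \<open>The factor 3 is 2 from the symmetric kernel plus 1 from the upper kernel;
    \<open>48 * \<kappa>^2\<close> belongs to the quadratic form.\<close>
  define C where "C = 48 * \<kappa>\<^sup>2 * (3 * (\<integral>x. (h\<^sub>1 x)\<^sup>2 \<partial>\<mu>))"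
  have increments: "integrable (path_measure P) (\<lambda>\<omega>. (Z t \<omega> - Z s \<omega>)^4) \<and>
      (\<integral>\<omega>. (Z t \<omega> - Z s \<omega>)^4 \<partial>path_measure P) \<le> C\<^sup>2 * (squared_cdf \<mu> h\<^sub>2 t - squared_cdf \<mu> h\<^sub>2 s)\<^sup>2"
    if "s \<le> t" for s t
  proof -
    define f f' where "f z = F t z - F s z" and "f' z = G t z - G s z" for z
    have f: "square_integrable (\<mu> \<Otimes>\<^sub>M \<mu>) f" "square_integrable (\<mu> \<Otimes>\<^sub>M \<mu>) f'"
      unfolding f_def[abs_def] f'_def[abs_def] by (intro square_integrable_minus F G)+
    have a_diff: "a (F t) j k - a (F s) j k = a f j k" "a (G t) j k - a (G s) j k = a f' j k" for j k
      unfolding a_def f_def[abs_def] f'_def[abs_def] by (simp_all add: L2_inner_diff F G tensor)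
    \<comment> \<open>The coefficients are linear in the kernel, so the increment is a limit of
      forms built from the kernel increments, however the representatives at \<open>s\<close> and
      \<open>t\<close> were chosen.\<close>
    have lim: "L2_limit (path_measure P) (\<lambda>n. quadratic_form (a f) (\<lambda>j. a f' j j) (Suc n)) (\<lambda>\<omega>. Z t \<omega> - Z s \<omega>)"
      using L2_limit_minus[OF Z_lim[of t] Z_lim[of s]] by (simp add: quadratic_form_diff a_diff)
    have nonneg: "0 \<le> (\<Sum>j<n. (\<Sum>k<j. (a f j k)\<^sup>2) + (a f' j j)\<^sup>2)" for n
      by (simp add: sum_nonneg add_nonneg_nonneg)
    have bound: "(\<integral>\<omega>. (quadratic_form (a f) (\<lambda>j. a f' j j) n \<omega>)^4 \<partial>path_measure P)
        \<le> C\<^sup>2 * (squared_cdf \<mu> h\<^sub>2 t - squared_cdf \<mu> h\<^sub>2 s)\<^sup>2" for n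
    proof -
      have "(\<Sum>j<n. (\<Sum>k<j. (a f j k)\<^sup>2) + (a f' j j)\<^sup>2)
          \<le> 3 * ((\<integral>x. (h\<^sub>1 x)\<^sup>2 \<partial>\<mu>) * (squared_cdf \<mu> h\<^sub>2 t - squared_cdf \<mu> h\<^sub>2 s))"
        using off_diagonal[OF f(1), of n] diagonal[OF f(2), of n] kernel_increments[OF that]
        unfolding f_def f'_def F_def G_def sum.distrib by linarith
      then have "(48 * \<kappa>\<^sup>2 * (\<Sum>j<n. (\<Sum>k<j. (a f j k)\<^sup>2) + (a f' j j)\<^sup>2))\<^sup>2
          \<le> (48 * \<kappa>\<^sup>2 * (3 * ((\<integral>x. (h\<^sub>1 x)\<^sup>2 \<partial>\<mu>) * (squared_cdf \<mu> h\<^sub>2 t - squared_cdf \<mu> h\<^sub>2 s))))\<^sup>2"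
        using nonneg by (intro power_mono mult_left_mono mult_nonneg_nonneg) auto
      also have "\<dots> = C\<^sup>2 * (squared_cdf \<mu> h\<^sub>2 t - squared_cdf \<mu> h\<^sub>2 s)\<^sup>2"
        by (simp add: C_def power_mult_distrib)
      finally show ?thesis
        using quadratic_form_fourth_moment[of "a f" "\<lambda>j. a f' j j" n] by linarith
    qed
    show ?thesis
      by (intro conjI L2_limit_fourth_moment_le[OF lim _ bound] all_moments_integrable
          all_moments_intros all_moments_quadratic_form)
  qed
  have "\<exists>Zc :: real \<Rightarrow> (nat \<Rightarrow> real) \<Rightarrow> real.
    (\<forall>t\<ge>0. Zc t \<in> borel_measurable (path_measure P)) \<and>
    (\<forall>\<omega>\<in>space (path_measure P). continuous_on {0..} (\<lambda>t. Zc t \<omega>)) \<and>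
    (\<forall>t\<ge>0. AE \<omega> in path_measure P. Zc t \<omega> = Z t \<omega>)"
  proof (rule Kolmogorov_continuity_time_change)
    show "Z t \<in> borel_measurable (path_measure P)" for t
      using Z_lim[of t] by (simp add: L2_limit_def square_integrable_def)
    show "continuous_on {0..} (squared_cdf \<mu> h\<^sub>2)"
      by (rule continuous_on_squared_cdf) (rule diffuse)
  qed (use increments squared_cdf_mono in auto)
  then show ?thesis
    by (simp add: Z_def)
qed

end
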